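(* Let $k\ge2$ be an integer, let $\mathcal{G}$ be a congruence subgroup of $\mathrm{SL}_2(\mathbb{Z})$ containing $\Gamma(N)$, and let $s\in\mathbb{C}$ with $\mathrm{Re}(k+2s)>2$. (i) Let $k$ be even and let $\mathcal{A}$ be a set of representatives for the $\{\pm\mathrm{Id}\}$-action on $\Lambda_N$. Then \[E_{k,x}(\tau;s)=\sum_{y\in\mathrm{or}_{\mathcal{G},N}(x)}\Phi_{N,\mathcal{A}}(y;s)\qquad\text{for all }x\in\mathcal{C}(\mathcal{G}).\] (ii) Let $k$ be odd and $-\mathrm{Id}\notin\mathcal{G}$. Given a $\mathcal{G}$-admissible choice of representatives $\mathcal{A}$, there exists a choice of scaling matrices $\{\sigma_x\mid x\in\mathcal{C}_\infty(\mathcal{G})\}$ so that \[E_{k,x}(\tau;s)=\sum_{y\in\mathrm{or}_{\mathcal{G},N}(x)}\Phi_{N,\mathcal{A}}(y;s)\qquad\text{for all }x\in\mathcal{C}_\infty(\mathcal{G}).\] Conversely, any choice of scaling matrix for each regular cusp determines a choice of $\mathcal{G}$-admissible representatives $\mathcal{A}$ so that \[E_{k,x}(\tau;s)=\sum_{y\in\mathrm{or}_{\mathcal{G},N}(x)}\Phi_{N,\mathcal{A}}(y;s)\qquad\text{for all }x\in\mathcal{C}_\infty(\mathcal{G}).\]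
   Context: $\Gamma=\mathrm{SL}_2(\mathbb{Z})$. $\Lambda_N$ is the set of elements of additive order $N$ in $\mathbb{Z}^2/N\mathbb{Z}^2$ (row vectors), with right $\Gamma$-action by matrix multiplication; $\Lambda_N^\pm=\Lambda_N/\{\pm\mathrm{Id}\}$, $\Pi_N:\Lambda_N\to\Lambda_N^\pm$ is the projection. For a set $\mathcal{A}\subseteq\Lambda_N$ of representatives for the $\{\pm\mathrm{Id}\}$-orbits, $\Pi_{N,\mathcal{A}}:\mathcal{A}\to\Lambda_N^\pm$ is the restricted bijection. A $\mathcal{G}$-orbit $\mathcal{O}\subseteq\Lambda_N$ is regular if $\mathcal{O}\cap(-\mathcal{O})=\emptyset$. $\mathcal{A}$ is $\mathcal{G}$-admissible if every regular $\mathcal{G}$-orbit $\mathcal{O}$ with $\mathcal{O}\cap\mathcal{A}\ne\emptyset$ satisfies $\mathcal{O}\subseteq\mathcal{A}$. $\mathcal{C}(\mathcal{G})$ is the set of cusps ($\mathcal{G}$-orbits in $\mathbb{P}^1(\mathbb{Q})$), each denoted by a fixed representative $x\in\mathbb{P}^1(\mathbb{Q})$; $\mathcal{G}_x$ is the stabilizer of $x$. With $T=\begin{pmatrix}1&1\\0&1\end{pmatrix}$ and $\gamma\in\Gamma$ with $\gamma\infty=x$, the cusp is irregular if $\gamma^{-1}\mathcal{G}_x\gamma=\langle-T^h\rangle$ for some $h\ge1$, regular otherwise; $\mathcal{C}_\infty(\mathcal{G})$ is the set of regular cusps. $\mathrm{or}_{\mathcal{G},N}(x)\subseteq\mathcal{C}(\Gamma(N))$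 is the $\mathcal{G}$-orbit of the cusp $\Gamma(N)x$ under $\gamma\cdot\Gamma(N)x=\Gamma(N)\gamma x$. The bijection $\phi_N:\mathcal{C}(\Gamma(N))\to\Lambda_N^\pm$ sends the class of $\frac\alpha\beta$, $\gcd(\alpha,\beta)=1$, to the class of $(\beta,-\alpha)$. With $\epsilon_N=1$ if $N\ge3$, $\epsilon_N=\frac12$ if $N\in\{1,2\}$, and $\lambda$ a lift of $\bar\lambda\in\Lambda_N$, \[E_k(\tau,\bar\lambda,N;s)=\epsilon_N\sum_{(c,d)\equiv\lambda\,(N),\ \gcd(c,d)=1}\frac{\mathrm{Im}(\tau)^s}{(c\tau+d)^k|c\tau+d|^{2s}},\] and $\Phi_{N,\mathcal{A}}(y;s):=E_k(\tau,\Pi_{N,\mathcal{A}}^{-1}\circ\phi_N(y),N;s)$ for $y\in\mathcal{C}(\Gamma(N))$. A scaling matrix for $x$ is $\sigma_x\in\Gamma$ with $\sigma_x\infty=x$. The spectral Eisenstein series is \[E_{k,x}(\tau;s)=\sum_{\gamma\in\mathcal{G}_x\backslash\mathcal{G}}\mathbf{j}(\sigma_x^{-1}\gamma,\tau)^{-k}(\mathrm{Im}\,\sigma_x^{-1}\gamma\tau)^s,\qquad \mathbf{j}\big(\begin{pmatrix}a&b\\c&d\end{pmatrix},\tau\big)=c\tau+d,\] which is well defined if $k$ is even (and then independent of $\sigma_x$), or if $k$ is odd, $-\mathrm{Id}\notin\mathcal{G}$ and $x$ is regular (then it depends on $\sigma_x$ up to sign). *)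

theory Defs
  imports "HOL-Analysis.Analysis" "HOL-Algebra.Algebra"
begin

definition SL2Z :: "(int^2^2) monoid" where
  "SL2Z = \<lparr>carrier = {A. det A = 1}, monoid.mult = (**), one = mat 1\<rparr>"

text \<open>A subgroup of \<open>SL2Z\<close> is given by its carrier \<open>G\<close>, as in \<^term>\<open>subgroup G SL2Z\<close>;
  \<open>grp G\<close> is the corresponding group structure.\<close>

abbreviation grp :: "(int^2^2) set \<Rightarrow> (int^2^2) monoid" where
  "grp G \<equiv> SL2Z\<lparr>carrier := G\<rparr>"

definition principal_congruence :: "nat \<Rightarrow> (int^2^2) set" where
  "principal_congruence N =
     {A \<in> carrier SL2Z. \<forall>i j. A $ i $ j mod int N = (mat 1 :: int^2^2) $ i $ j mod int N}"

definition T_mat :: "int^2^2" where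
  "T_mat = vector [vector [1, 1], vector [0, 1]]"

text \<open>Elements of \<open>\<int>\<^sup>2 / N\<int>\<^sup>2\<close> are represented by pairs of residues in \<open>{0..<N}\<close>
  (for \<open>N \<ge> 1\<close>); \<open>red_vec N\<close> is the reduction map.\<close>

definition red_vec :: "nat \<Rightarrow> int \<times> int \<Rightarrow> int \<times> int" where
  "red_vec N v = (fst v mod int N, snd v mod int N)"

definition Lam :: "nat \<Rightarrow> (int \<times> int) set" where
  "Lam N = {v \<in> carrier (integer_mod_group N \<times>\<times> integer_mod_group N).
              group.ord (integer_mod_group N \<times>\<times> integer_mod_group N) v = N}"

definition vec_act :: "nat \<Rightarrow> int^2^2 \<Rightarrow> int \<times> int \<Rightarrow> int \<times> int" where
  "vec_act N A v = red_vec N (fst v * A$1$1 + snd v * A$2$1, fst v * A$1$2 + snd v * A$2$2)"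

definition neg_vec :: "nat \<Rightarrow> int \<times> int \<Rightarrow> int \<times> int" where
  "neg_vec N v = red_vec N (- fst v, - snd v)"

definition Pi_pm :: "nat \<Rightarrow> int \<times> int \<Rightarrow> (int \<times> int) set" where
  "Pi_pm N v = {v, neg_vec N v}"

definition Lam_pm :: "nat \<Rightarrow> (int \<times> int) set set" where
  "Lam_pm N = Pi_pm N ` Lam N"

definition pm_representatives :: "nat \<Rightarrow> (int \<times> int) set \<Rightarrow> bool" where
  "pm_representatives N \<A> \<longleftrightarrow> \<A> \<subseteq> Lam N \<and> (\<forall>P\<in>Lam_pm N. \<exists>!v. v \<in> \<A> \<inter> P)"

text \<open>The action of \<open>SL2Z\<close> on row vectors is a right action. The constant \<^const>\<open>orbits\<close>
  only collects the sets \<open>{v g | g \<in> G}\<close>, hence serves for right actions as well.\<close>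

definition admissible :: "(int^2^2) set \<Rightarrow> nat \<Rightarrow> (int \<times> int) set \<Rightarrow> bool" where
  "admissible G N \<A> \<longleftrightarrow>
     (\<forall>Q\<in>orbits (grp G) (Lam N) (vec_act N).
        Q \<inter> neg_vec N ` Q = {} \<longrightarrow> Q \<inter> \<A> \<noteq> {} \<longrightarrow> Q \<subseteq> \<A>)"

datatype proj_rat = Infty | Fin rat

fun moebius_rat :: "int^2^2 \<Rightarrow> proj_rat \<Rightarrow> proj_rat" where
  "moebius_rat A Infty =
     (if A$2$1 = 0 then Infty else Fin (of_int (A$1$1) / of_int (A$2$1)))"
| "moebius_rat A (Fin q) =
     (if of_int (A$2$1) * q + of_int (A$2$2) = 0 then Infty
      else Fin ((of_int (A$1$1) * q + of_int (A$1$2)) / (of_int (A$2$1) * q + of_int (A$2$2))))"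

definition cusp_class :: "(int^2^2) set \<Rightarrow> proj_rat \<Rightarrow> proj_rat set" where
  "cusp_class G x = orbit (grp G) moebius_rat x"

definition cusps :: "(int^2^2) set \<Rightarrow> proj_rat set set" where
  "cusps G = orbits (grp G) UNIV moebius_rat"

text \<open>A fixed choice of one point in every cusp; such a set \<open>R\<close> stands for the set of
  cusps whenever cusps are denoted by representatives.\<close>

definition cusp_representatives :: "(int^2^2) set \<Rightarrow> proj_rat set \<Rightarrow> bool" where
  "cusp_representatives G R \<longleftrightarrow> (\<forall>C\<in>cusps G. \<exists>!x. x \<in> R \<inter> C)"

definition cusp_stab :: "(int^2^2) set \<Rightarrow> proj_rat \<Rightarrow> (int^2^2) set" where
  "cusp_stab G x = stabilizer (grp G) moebius_rat x"

definition scaling_matrix :: "proj_rat \<Rightarrow> int^2^2 \<Rightarrow> bool" where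
  "scaling_matrix x \<sigma> \<longleftrightarrow> \<sigma> \<in> carrier SL2Z \<and> moebius_rat \<sigma> Infty = x"

text \<open>The condition does not depend on \<open>\<gamma>\<close>, which is unique up to right multiplication by
  \<open>\<plusminus>T\<^sup>n\<close>.\<close>

definition irregular_cusp :: "(int^2^2) set \<Rightarrow> proj_rat \<Rightarrow> bool" where
  "irregular_cusp G x \<longleftrightarrow>
     (\<exists>\<gamma>\<in>carrier SL2Z. moebius_rat \<gamma> Infty = x \<and>
        (\<exists>h::nat. h \<ge> 1 \<and>
           {inv\<^bsub>SL2Z\<^esub> \<gamma> \<otimes>\<^bsub>SL2Z\<^esub> g \<otimes>\<^bsub>SL2Z\<^esub> \<gamma> | g. g \<in> cusp_stab G x} =
           generate SL2Z {- (T_mat [^]\<^bsub>SL2Z\<^esub> h)}))"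

definition regular_cusps :: "(int^2^2) set \<Rightarrow> proj_rat set \<Rightarrow> proj_rat set" where
  "regular_cusps G R = {x \<in> R. \<not> irregular_cusp G x}"

definition or_cusps :: "(int^2^2) set \<Rightarrow> nat \<Rightarrow> proj_rat \<Rightarrow> proj_rat set set" where
  "or_cusps G N x =
     {cusp_class (principal_congruence N) (moebius_rat \<gamma> x) | \<gamma>. \<gamma> \<in> G}"

text \<open>The vector \<open>(\<beta>, -\<alpha>)\<close> for \<open>\<alpha>/\<beta>\<close> in lowest terms, with \<open>\<infinity> = 1/0\<close>;
  \<^const>\<open>quotient_of\<close> gives the reduced fraction with positive denominator.\<close>

fun cusp_vec :: "proj_rat \<Rightarrow> int \<times> int" where
  "cusp_vec Infty = (0, -1)"
| "cusp_vec (Fin q) = (snd (quotient_of q), - fst (quotient_of q))"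

text \<open>The value at a cusp of \<open>\<Gamma>(N)\<close> does not depend on the chosen point of it.\<close>

definition phi :: "nat \<Rightarrow> proj_rat set \<Rightarrow> (int \<times> int) set" where
  "phi N y = Pi_pm N (red_vec N (cusp_vec (SOME x. x \<in> y)))"

definition eps :: "nat \<Rightarrow> complex" where
  "eps N = (if N \<ge> 3 then 1 else 1 / 2)"

definition E_vec :: "nat \<Rightarrow> complex \<Rightarrow> int \<times> int \<Rightarrow> nat \<Rightarrow> complex \<Rightarrow> complex" where
  "E_vec k \<tau> v N s = eps N *
     (\<Sum>\<^sub>\<infinity>(c, d)\<in>{(c, d). red_vec N (c, d) = v \<and> coprime c d}.
        of_real (Im \<tau>) powr s /
        ((of_int c * \<tau> + of_int d) ^ k *
         of_real (cmod (of_int c * \<tau> + of_int d)) powr (2 * s)))"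

definition Phi :: "nat \<Rightarrow> nat \<Rightarrow> (int \<times> int) set \<Rightarrow> complex \<Rightarrow> proj_rat set \<Rightarrow> complex \<Rightarrow> complex" where
  "Phi k N \<A> \<tau> y s = E_vec k \<tau> (inv_into \<A> (Pi_pm N) (phi N y)) N s"

definition j_factor :: "int^2^2 \<Rightarrow> complex \<Rightarrow> complex" where
  "j_factor A \<tau> = of_int (A$2$1) * \<tau> + of_int (A$2$2)"

definition moebius :: "int^2^2 \<Rightarrow> complex \<Rightarrow> complex" where
  "moebius A \<tau> = (of_int (A$1$1) * \<tau> + of_int (A$1$2)) / (of_int (A$2$1) * \<tau> + of_int (A$2$2))"

text \<open>The sum runs over the cosets \<open>\<G>\<^sub>x \<gamma>\<close>, and each term is evaluated at an
  arbitrary element of its coset. The scaling matrix is a parameter since for odd \<open>k\<close> it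
  affects the sign.\<close>

definition E_spectral ::
  "(int^2^2) set \<Rightarrow> nat \<Rightarrow> proj_rat \<Rightarrow> int^2^2 \<Rightarrow> complex \<Rightarrow> complex \<Rightarrow> complex" where
  "E_spectral G k x \<sigma> \<tau> s =
     (\<Sum>\<^sub>\<infinity>C\<in>rcosets\<^bsub>grp G\<^esub> (cusp_stab G x).
        let \<gamma> = (SOME \<gamma>. \<gamma> \<in> C); A = inv\<^bsub>SL2Z\<^esub> \<sigma> \<otimes>\<^bsub>SL2Z\<^esub> \<gamma>
        in j_factor A \<tau> powi (- int k) * of_real (Im (moebius A \<tau>)) powr s)"

end

theory Submission
  imports Defs
begin

text \<open>
  Both Eisenstein series are sums of one function of a primitive row \<open>(c, d)\<close>, namely
  \<open>eis_term\<close>, so the identity is a comparison of index sets.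

  A scaling matrix \<open>\<sigma>\<close> of a cusp \<open>x\<close> matters only through the bottom row \<open>u\<close> of its
  inverse, which is a primitive row with pole \<open>x\<close>, determined by \<open>x\<close> up to sign. The summand
  of \<open>\<gamma> \<in> G\<close> in the spectral series is the one of the row \<open>u\<gamma>\<close>, and two elements lie in the
  same coset of the stabilizer iff their rows agree up to sign. So the spectral series runs over
  a set that contains one of each pair \<open>\<plusminus>w\<close> with \<open>w\<close> in the orbit \<open>u G\<close>: a sign section of
  the orbit (\<open>E_spectral_section\<close>).

  On the other side, \<open>\<Gamma>(N)\<close> acts transitively on the primitive rows in a residue class
  modulo \<open>N\<close> (\<open>principal_congruence_transitive\<close>). Consequently \<open>u G\<close> is a union of residue
  classes of primitive rows, the map \<open>\<phi>\<^sub>N\<close> is injective, and it identifies the cusps over \<open>x\<close> with the vectors of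
  the reduced orbit up to sign. The sum over these cusps thus runs over the rows that reduce
  into \<open>\<A>\<close> and agree up to sign with a row of the orbit (for \<open>N \<le> 2\<close>, over one half
  of them, because of the factor \<open>1/2\<close>), which is again a sign section
  (\<open>sum_Phi_section\<close>, \<open>half_class_section\<close>). The series converge absolutely for
  \<open>Re (k + 2s) > 2\<close>, so the finitely many series may be joined (\<open>eis_term_summable\<close>).

  For even \<open>k\<close> the summand does not see the sign of the row, and any two sections give the
  same sum. For odd \<open>k\<close> the two sections have to coincide. If \<open>-1 \<notin> G\<close>, then \<open>x\<close> is regular
  iff \<open>-u\<close> is not in \<open>u G\<close> (\<open>irregular_cusp_iff\<close>). In that case the first section is \<open>u G\<close>
  itself, and the second one is as soon as the reduced orbit is contained in \<open>\<A>\<close>. This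
  condition links the two kinds of choices: an admissible \<open>\<A>\<close> contains the reduced orbit of
  either \<open>u\<close> or \<open>-u\<close>, which determines the sign of \<open>\<sigma>\<close> (\<open>scaling_from_admissible\<close>), and
  conversely the orbits given by the scaling matrices can be completed to an admissible set
  (\<open>admissible_from_scaling\<close>).
\<close>

section \<open>Integral row vectors and the modular group\<close>

definition row_mul :: "int \<times> int \<Rightarrow> int^2^2 \<Rightarrow> int \<times> int" (infixl \<open>\<star>\<close> 70) where
  "v \<star> A = (fst v * A$1$1 + snd v * A$2$1, fst v * A$1$2 + snd v * A$2$2)"

definition prim :: "int \<times> int \<Rightarrow> bool" where
  "prim v \<longleftrightarrow> coprime (fst v) (snd v)"

text \<open>The zero of the linear form \<open>c\<tau> + d\<close> on the projective line over \<open>\<rat>\<close>.\<close>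

definition pole :: "int \<times> int \<Rightarrow> proj_rat" where
  "pole v = (if fst v = 0 then Infty else Fin (- of_int (snd v) / of_int (fst v)))"

text \<open>The bottom row of \<open>\<sigma>\<inverse>\<close> for \<open>\<sigma>\<close> of determinant one.\<close>

definition inv_row :: "int^2^2 \<Rightarrow> int \<times> int" where
  "inv_row \<sigma> = (- \<sigma>$2$1, \<sigma>$1$1)"

lemma mat_eq_iff_2x2:
  "A = B \<longleftrightarrow> A$1$1 = B$1$1 \<and> A$1$2 = B$1$2 \<and> A$2$1 = B$2$1 \<and> A$2$2 = (B :: int^2^2)$2$2"
  by (auto simp: vec_eq_iff forall_2)

lemma mult_2x2_nth [simp]:
  "((A :: int^2^2) ** B)$i$j = A$i$1 * B$1$j + A$i$2 * B$2$j"
  by (simp add: matrix_matrix_mult_def sum_2)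

lemma mat_1_nth_2x2 [simp]:
  "(mat 1 :: int^2^2)$1$1 = 1" "(mat 1 :: int^2^2)$1$2 = 0"
  "(mat 1 :: int^2^2)$2$1 = 0" "(mat 1 :: int^2^2)$2$2 = 1"
  by (simp_all add: mat_def)

lemma SL2Z_simps [simp]:
  "A \<in> carrier SL2Z \<longleftrightarrow> A$1$1 * A$2$2 - A$1$2 * A$2$1 = 1"
  "A \<otimes>\<^bsub>SL2Z\<^esub> B = A ** B" "\<one>\<^bsub>SL2Z\<^esub> = mat 1"
  by (simp_all add: SL2Z_def det_2)

lemma group_SL2Z: "group SL2Z"
proof (rule groupI)
  fix A B C :: "int^2^2"
  assume A: "A \<in> carrier SL2Z" and B: "B \<in> carrier SL2Z"
  have "det (A ** B) = 1" using A B by (simp add: det_mul SL2Z_def)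
  then show "A \<otimes>\<^bsub>SL2Z\<^esub> B \<in> carrier SL2Z" by (simp add: SL2Z_def)
next
  fix A assume A: "A \<in> carrier SL2Z"
  let ?B = "vector [vector [A$2$2, - A$1$2], vector [- A$2$1, A$1$1]] :: int^2^2"
  have "?B \<in> carrier SL2Z" "?B \<otimes>\<^bsub>SL2Z\<^esub> A = \<one>\<^bsub>SL2Z\<^esub>"
    using A by (simp_all add: mat_eq_iff_2x2 algebra_simps)
  then show "\<exists>B\<in>carrier SL2Z. B \<otimes>\<^bsub>SL2Z\<^esub> A = \<one>\<^bsub>SL2Z\<^esub>" by blast
qed (simp_all add: matrix_mul_assoc)

interpretation SL: group SL2Z
  by (rule group_SL2Z)

lemma row_mul_mult: "v \<star> (A ** B) = v \<star> A \<star> B"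
  by (simp add: row_mul_def algebra_simps)

lemma row_mul_one [simp]: "v \<star> mat 1 = v"
  by (simp add: row_mul_def)

lemma row_mul_uminus [simp]: "(- v) \<star> A = - (v \<star> A)" 
  by (simp add: row_mul_def)

lemma row_mul_uminus_mat [simp]: "v \<star> (- A) = - (v \<star> A)" 
  by (simp add: row_mul_def)

lemma row_mul_inv [simp]:
  assumes "A \<in> carrier SL2Z"
  shows "v \<star> inv\<^bsub>SL2Z\<^esub> A \<star> A = v" "v \<star> A \<star> inv\<^bsub>SL2Z\<^esub> A = v"
proof -
  have "inv\<^bsub>SL2Z\<^esub> A ** A = mat 1" "A ** inv\<^bsub>SL2Z\<^esub> A = mat 1" 
    using SL.l_inv[OF assms] SL.r_inv[OF assms] by simp_all
  then show "v \<star> inv\<^bsub>SL2Z\<^esub> A \<star> A = v" "v \<star> A \<star> inv\<^bsub>SL2Z\<^esub> A = v"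
    by (simp_all flip: row_mul_mult)
qed

lemma row_mul_inv_row:
  assumes "\<sigma> \<in> carrier SL2Z"
  shows "inv_row \<sigma> \<star> \<sigma> = (0, 1)" "(0, 1) \<star> inv\<^bsub>SL2Z\<^esub> \<sigma> = inv_row \<sigma>"
proof -
  show *: "inv_row \<sigma> \<star> \<sigma> = (0, 1)"
    using assms by (simp add: inv_row_def row_mul_def algebra_simps)
  show "(0, 1) \<star> inv\<^bsub>SL2Z\<^esub> \<sigma> = inv_row \<sigma>"
    using row_mul_inv(2)[OF assms, of "inv_row \<sigma>"] * by simp
qed

lemma prim_uminus [simp]: "prim (- v) \<longleftrightarrow> prim v"
  by (simp add: prim_def)

lemma prim_nonzero: "prim v \<Longrightarrow> v \<noteq> - v" "prim v \<Longrightarrow> v \<noteq> 0"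
  by (auto simp: prim_def prod_eq_iff)

lemma prim_row_mul:
  assumes "A \<in> carrier SL2Z"
  shows "prim (v \<star> A) \<longleftrightarrow> prim v"
proof -
  have *: "prim w" if "prim (w \<star> B)" for w B
    unfolding prim_def
  proof (rule coprimeI)
    fix c assume "c dvd fst w" "c dvd snd w"
    then have "c dvd fst (w \<star> B)" "c dvd snd (w \<star> B)" by (auto simp: row_mul_def)
    with that show "is_unit c" by (auto simp: prim_def dest: coprime_common_divisor)
  qed
  show ?thesis
    using *[of v A] *[of "v \<star> A" "inv\<^bsub>SL2Z\<^esub> A"] row_mul_inv[OF assms] by auto
qed

lemma prim_inv_row:
  assumes "\<sigma> \<in> carrier SL2Z"
  shows "prim (inv_row \<sigma>)"
  using prim_row_mul[OF assms, of "inv_row \<sigma>"] by (simp add: row_mul_inv_row[OF assms] prim_def)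

text \<open>Bezout coefficients complete a primitive row to a matrix of determinant one. Thus scaling matrices can be replaced by primitive rows.\<close>

lemma prim_imp_inv_row:
  assumes "prim v"
  shows "\<exists>\<sigma>\<in>carrier SL2Z. inv_row \<sigma> = v"
proof -
  obtain p q where pq: "p * fst v + q * snd v = 1"
    using assms bezout_int[of "fst v" "snd v"] by (auto simp: prim_def coprime_iff_gcd_eq_1)
  let ?\<sigma> = "vector [vector [snd v, p], vector [- fst v, q]] :: int^2^2"
  have "?\<sigma> \<in> carrier SL2Z" "inv_row ?\<sigma> = v"
    using pq by (simp_all add: inv_row_def algebra_simps)
  then show ?thesis by blast
qed

lemma prim_transitive:
  assumes "prim v" "prim w"
  shows "\<exists>A\<in>carrier SL2Z. v \<star> A = w"
proof -
  obtain \<sigma> \<rho> where \<sigma>: "\<sigma> \<in> carrier SL2Z" "inv_row \<sigma> = v" and \<rho>: "\<rho> \<in> carrier SL2Z" "inv_row \<rho> = w"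
    using assms prim_imp_inv_row by meson
  have "v \<star> (\<sigma> \<otimes>\<^bsub>SL2Z\<^esub> inv\<^bsub>SL2Z\<^esub> \<rho>) = w"
    using \<sigma> \<rho> row_mul_inv_row by (auto simp: row_mul_mult)
  moreover have "\<sigma> \<otimes>\<^bsub>SL2Z\<^esub> inv\<^bsub>SL2Z\<^esub> \<rho> \<in> carrier SL2Z" 
    using \<sigma> \<rho> by (intro SL.m_closed SL.inv_closed)
  ultimately show ?thesis by blast
qed

section \<open>Rows and points of the projective line\<close>

text \<open>If \<open>c\<tau> + d\<close> is the form of \<open>v\<close>, then the form of \<open>v A\<close> is its pullback along \<open>\<tau> \<mapsto> A\<tau>\<close> up to the factor \<open>j(A, \<tau>)\<close>, so \<open>A\<close> maps the zero of the second form to that of the first. The left action on cusps becomes the right action on rows.\<close>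

lemma moebius_rat_pole:
  assumes "A \<in> carrier SL2Z" "v \<noteq> 0"
  shows "moebius_rat A (pole (v \<star> A)) = pole v"
proof -
  obtain c d where v: "v = (c, d)" by fastforce
  define a11 a12 a21 a22 :: rat where "a11 = of_int (A$1$1)" and "a12 = of_int (A$1$2)"
    and "a21 = of_int (A$2$1)" and "a22 = of_int (A$2$2)"
  define x y :: rat where "x = of_int c" and "y = of_int d"
  have "of_int (A$1$1 * A$2$2 - A$1$2 * A$2$1) = (1 :: rat)" using assms by simp
  then have det: "a11 * a22 - a12 * a21 = 1" by (simp add: a11_def a12_def a21_def a22_def)
  have nz: "x \<noteq> 0 \<or> y \<noteq> 0" using assms v by (auto simp: x_def y_def zero_prod_def)
  define p q where "p = x * a11 + y * a21" and "q = x * a12 + y * a22"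
  have "p * a22 - q * a21 = x * (a11 * a22 - a12 * a21)"
    "q * a11 - p * a12 = y * (a11 * a22 - a12 * a21)"
    by (simp_all add: p_def q_def algebra_simps)
  then have x: "x = p * a22 - q * a21" and y: "y = q * a11 - p * a12"
    unfolding det by simp_all
  have pole_w: "pole (v \<star> A) = (if p = 0 then Infty else Fin (- q / p))"
    unfolding pole_def v row_mul_def p_def q_def x_def y_def a11_def a12_def a21_def a22_def
    by (simp flip: of_int_mult of_int_add)
  have pole_v: "pole v = (if x = 0 then Infty else Fin (- y / x))"
    by (simp add: pole_def v x_def y_def)
  have mI: "moebius_rat A Infty = (if a21 = 0 then Infty else Fin (a11 / a21))"
    by (simp add: a11_def a21_def)
  have mF: "moebius_rat A (Fin r) = (if a21 * r + a22 = 0 then Infty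
      else Fin ((a11 * r + a12) / (a21 * r + a22)))" for r
    by (simp add: a11_def a12_def a21_def a22_def)
  show ?thesis
  proof (cases "p = 0")
    case True
    then have "q \<noteq> 0" using nz x y by auto
    then show ?thesis using True x y by (simp add: pole_w pole_v mI del: moebius_rat.simps)
  next
    case False
    have "a21 * (- q / p) + a22 = x / p" "a11 * (- q / p) + a12 = - y / p"
      using False by (simp_all add: x y field_simps)
    then show ?thesis using False by (simp add: pole_w pole_v mF del: moebius_rat.simps)
  qed
qed

lemma pole_uminus [simp]: "pole (- v) = pole v"
  by (simp add: pole_def)

text \<open>A reduced fraction determines its numerator and denominator up to a common sign. This sign is the only difference between rows and points, and it causes all distinctions between even and odd weight.\<close>

lemma pole_eq_iff:
  assumes "prim v" "prim w"
  shows "pole v = pole w \<longleftrightarrow> w = v \<or> w = - v"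
proof
  assume eq: "pole v = pole w"
  obtain a b c d where vw: "v = (a, b)" "w = (c, d)" by fastforce
  have cop: "coprime a b" "coprime c d" using assms vw by (auto simp: prim_def)
  have "a * d = b * c"
  proof (cases "a = 0")
    case True
    then show ?thesis using eq vw by (auto simp: pole_def split: if_splits)
  next
    case False
    then have "c \<noteq> 0" and "of_int b / of_int a = (of_int d / of_int c :: rat)"
      using eq vw by (auto simp: pole_def split: if_splits)
    then have "of_int (a * d) = (of_int (b * c) :: rat)" using False by (simp add: field_simps)
    then show ?thesis by (simp only: of_int_eq_iff)
  qed
  moreover have "\<bar>a\<bar> = \<bar>c\<bar> \<and> \<bar>d\<bar> = \<bar>b\<bar>"
  proof -
    have "\<bar>a\<bar> * \<bar>d\<bar> = \<bar>c\<bar> * \<bar>b\<bar>"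
      using \<open>a * d = b * c\<close> by (metis abs_mult mult.commute)
    then show ?thesis
      using coprime_crossproduct_int[of a b c d] cop by (auto simp: coprime_commute)
  qed
  ultimately have "(c = a \<and> d = b) \<or> (c = - a \<and> d = - b)"
    using cop by (auto simp: abs_eq_iff)
  then show "w = v \<or> w = - v" using vw by auto
qed auto

lemma prim_cusp_vec: "prim (cusp_vec x)"
  by (cases x) (auto simp: prim_def coprime_commute quotient_of_coprime[OF surjective_pairing])

lemma pole_cusp_vec: "pole (cusp_vec x) = x"
proof (cases x)
  case (Fin q)
  have "q = of_int (fst (quotient_of q)) / of_int (snd (quotient_of q))"
    by (rule quotient_of_div) simp
  then show ?thesis 
    using Fin quotient_of_denom_pos'[of q] by (simp add: pole_def)
qed (simp add: pole_def)

lemma pole_inv_row: "pole (inv_row \<sigma>) = moebius_rat \<sigma> Infty"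
  by (simp add: pole_def inv_row_def)

lemma scaling_matrix_iff: 
  "scaling_matrix x \<sigma> \<longleftrightarrow> \<sigma> \<in> carrier SL2Z \<and> pole (inv_row \<sigma>) = x"
  by (simp add: scaling_matrix_def pole_inv_row)

lemma inv_row_uminus [simp]: "inv_row (- \<sigma>) = - inv_row \<sigma>"
  by (simp add: inv_row_def)

section \<open>The terms of the Eisenstein series\<close>

text \<open>The common summand of both kinds of Eisenstein series, as a function of the row \<open>(c, d)\<close>.\<close>

definition eis_term :: "nat \<Rightarrow> complex \<Rightarrow> complex \<Rightarrow> int \<times> int \<Rightarrow> complex" where
  "eis_term k s \<tau> = (\<lambda>(c, d). of_real (Im \<tau>) powr s /
     ((of_int c * \<tau> + of_int d) ^ k * of_real (cmod (of_int c * \<tau> + of_int d)) powr (2 * s)))"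

lemma summable_on_int_powr:
  assumes "(r :: real) > 1"
  shows "(\<lambda>n :: int. (1 + \<bar>of_int n\<bar>) powr - r) summable_on UNIV"
proof -
  define f where "f = (\<lambda>n :: int. (1 + \<bar>of_int n\<bar>) powr - r)"
  have "summable (\<lambda>n. real (Suc n) powr - r)"
    using summable_real_powr_iff[of "- r"] assms by (subst summable_Suc_iff) simp
  then have nat: "(\<lambda>n. f (int n)) summable_on UNIV"
    by (intro norm_summable_imp_summable_on) (simp add: f_def add.commute)
  have "f summable_on range int" 
    using nat by (subst summable_on_reindex) (auto simp: o_def)
  moreover have "f summable_on range (\<lambda>n. - int n)"
    using nat by (subst summable_on_reindex) (auto simp: o_def f_def inj_on_def)
  ultimately have "f summable_on (range int \<union> range (\<lambda>n. - int n))"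
    by (rule summable_on_union)
  moreover have "range int \<union> range (\<lambda>n. - int n) = UNIV"
    by (auto simp: image_iff) (metis int_cases2)
  ultimately show ?thesis by (simp add: f_def)
qed

text \<open>Both \<open>\<bar>c\<bar>\<close> and \<open>\<bar>d\<bar>\<close> are at most a multiple of \<open>\<bar>c\<tau> + d\<bar>\<close>. Bounding the product of the two factors, rather than their sum, makes the dominating double series factor into two single series.\<close>

lemma lattice_growth:
  assumes "Im \<tau> > 0"
  shows "\<exists>M>0. \<forall>c d :: int. (c, d) \<noteq> 0 \<longrightarrow> 
    (1 + \<bar>of_int c\<bar>) * (1 + \<bar>of_int d\<bar>) \<le> (M * cmod (of_int c * \<tau> + of_int d))\<^sup>2"
proof (intro exI conjI allI impI)
  define L where "L = 1 / Im \<tau> + (1 + cmod \<tau> / Im \<tau>)"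
  show "2 * L > 0" using assms by (simp add: L_def add_pos_nonneg)
  fix c d :: int assume nz: "(c, d) \<noteq> 0"
  let ?z = "of_int c * \<tau> + of_int d"
  have "\<bar>of_int c\<bar> * Im \<tau> \<le> cmod ?z"
    using abs_Im_le_cmod[of ?z] assms by (simp add: abs_mult)
  then have c: "\<bar>of_int c\<bar> \<le> cmod ?z / Im \<tau>" using assms by (simp add: field_simps)
  have "\<bar>of_int d\<bar> = cmod (?z - of_int c * \<tau>)" by simp
  also have "\<dots> \<le> cmod ?z + \<bar>of_int c\<bar> * cmod \<tau>"
    by (metis norm_triangle_ineq4 norm_mult norm_of_int)
  also have "\<dots> \<le> cmod ?z + cmod ?z / Im \<tau> * cmod \<tau>"
    using c by (intro add_left_mono mult_right_mono) auto
  finally have "\<bar>of_int c\<bar> + \<bar>of_int d\<bar> \<le> L * cmod ?z"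
    using c by (simp add: L_def algebra_simps)
  moreover have "(1::real) \<le> \<bar>of_int c\<bar> + \<bar>of_int d\<bar>"
  proof -
    have "(1 :: int) \<le> \<bar>c\<bar> + \<bar>d\<bar>" using nz by (auto simp: zero_prod_def)
    then show ?thesis by linarith
  qed
  ultimately have "1 + \<bar>of_int c\<bar> \<le> 2 * L * cmod ?z" "1 + \<bar>of_int d\<bar> \<le> 2 * L * cmod ?z"
    by linarith+
  then show "(1 + \<bar>of_int c\<bar>) * (1 + \<bar>of_int d\<bar>) \<le> (2 * L * cmod ?z)\<^sup>2"
    unfolding power2_eq_square by (intro mult_mono) auto
qed

text \<open>By the growth bound, the absolute values are dominated by a multiple of \<open>((1 + \<bar>c\<bar>)(1 + \<bar>d\<bar>))\<close> to the power \<open>-Re (k + 2s) / 2\<close>, whose exponent lies below \<open>-1\<close>. Summability is what permits splitting and joining the infinite sums.\<close>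

lemma eis_term_summable:
  assumes "Im \<tau> > 0" "Re (of_nat k + 2 * s) > 2" "\<And>v. v \<in> S \<Longrightarrow> prim v"
  shows "eis_term k s \<tau> summable_on S"
proof -
  define r where "r = Re (of_nat k + 2 * s) / 2"
  have r: "r > 1" using assms by (simp add: r_def)
  define h where "h = (\<lambda>n :: int. (1 + \<bar>real_of_int n\<bar>) powr - r)"
  have h: "h summable_on UNIV" unfolding h_def by (rule summable_on_int_powr[OF r])
  obtain M where M: "M > 0" and growth: "\<And>c d :: int. (c, d) \<noteq> 0 \<Longrightarrow>
    (1 + \<bar>of_int c\<bar>) * (1 + \<bar>of_int d\<bar>) \<le> (M * cmod (of_int c * \<tau> + of_int d))\<^sup>2"
    using lattice_growth[OF assms(1)] by blast
  \<comment> \<open>The double series factors into two copies of a convergent single series.\<close>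
  have "(\<lambda>(c, d). h c * h d) summable_on UNIV \<times> UNIV"
  proof (rule summable_on_SigmaI)
    show "((\<lambda>d. case (c, d) of (c, d) \<Rightarrow> h c * h d) has_sum h c * infsum h UNIV) UNIV" for c
      using has_sum_infsum[OF h] by (auto intro: has_sum_cmult_right)
    show "(\<lambda>c. h c * infsum h UNIV) summable_on UNIV"
      using h by (rule summable_on_cmult_left)
  qed (auto simp: h_def)
  then have "(\<lambda>v. cmod (of_real (Im \<tau>) powr s) * M powr (2 * r) * (\<lambda>(c, d). h c * h d) v)
     summable_on UNIV"
    by (intro summable_on_cmult_right) simp
  then have dom: "(\<lambda>v. cmod (of_real (Im \<tau>) powr s) * M powr (2 * r) * (\<lambda>(c, d). h c * h d) v)
     summable_on S"
    by (rule summable_on_subset_banach) simp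
  have "(\<lambda>v. norm (eis_term k s \<tau> v)) summable_on S"
  proof (rule summable_on_comparison_test[OF dom])
    fix v assume "v \<in> S"
    obtain c d where v: "v = (c, d)" by fastforce
    have nz: "(c, d) \<noteq> 0" using assms(3)[OF \<open>v \<in> S\<close>] v prim_nonzero by auto
    let ?z = "of_int c * \<tau> + of_int d"
    let ?P = "(1 + \<bar>real_of_int c\<bar>) * (1 + \<bar>real_of_int d\<bar>)"
    have le: "?P \<le> (M * cmod ?z)\<^sup>2" by (rule growth[OF nz])
    have P: "?P > 0" by simp
    have "(M * cmod ?z)\<^sup>2 > 0" using le P by linarith
    then have z: "cmod ?z > 0" by (simp add: zero_less_norm_iff)
    have "cmod (?z ^ k * of_real (cmod ?z) powr (2 * s)) = cmod ?z powr (2 * r)"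
    proof -
      have "2 * r = real k + 2 * Re s" by (simp add: r_def)
      then show ?thesis
        using z by (simp add: norm_mult norm_power norm_powr_real_powr powr_add powr_realpow)
    qed
    then have "norm (eis_term k s \<tau> v) = cmod (of_real (Im \<tau>) powr s) * cmod ?z powr - (2 * r)"
      unfolding eis_term_def v case_prod_conv norm_divide by (simp add: powr_minus divide_inverse)
    also have "cmod ?z powr - (2 * r) = M powr (2 * r) * ((M * cmod ?z)\<^sup>2) powr - r"
    proof -
      have "((M * cmod ?z)\<^sup>2) powr - r = (M * cmod ?z) powr - (2 * r)"
        using M z by (simp add: powr_powr flip: powr_numeral)
      then show ?thesis using M z by (simp add: powr_mult powr_minus field_simps)
    qed
    also have "\<dots> \<le> M powr (2 * r) * ?P powr - r"
      using le P r by (intro mult_left_mono powr_mono2') auto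
    also have "?P powr - r = h c * h d" by (simp add: h_def powr_mult)
    finally show "norm (eis_term k s \<tau> v) \<le>
      cmod (of_real (Im \<tau>) powr s) * M powr (2 * r) * (\<lambda>(c, d). h c * h d) v"
      by (simp add: v mult_left_mono mult.assoc)
  qed simp
  then show ?thesis by (rule abs_summable_summable)
qed

lemma eis_term_uminus: "even k \<Longrightarrow> eis_term k s \<tau> (- v) = eis_term k s \<tau> v"
proof -
  assume k: "even k"
  obtain c d where v: "v = (c, d)" by fastforce
  have "of_int (- c) * \<tau> + of_int (- d) = - (of_int c * \<tau> + of_int d)" by simp
  then show ?thesis unfolding eis_term_def v uminus_Pair case_prod_conv using k by (simp only: power_minus_even norm_minus_cancel)
qed

text \<open>The imaginary part of \<open>A\<tau>\<close> is \<open>Im \<tau> / \<bar>c\<tau> + d\<bar>\<^sup>2\<close>, so a summand depends on the bottom row of \<open>A\<close> only.\<close>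

lemma spectral_term:
  assumes "A \<in> carrier SL2Z" "Im \<tau> > 0"
  shows "j_factor A \<tau> powi (- int k) * of_real (Im (moebius A \<tau>)) powr s = eis_term k s \<tau> ((0, 1) \<star> A)"
proof -
  define z where "z = of_int (A$2$1) * \<tau> + of_int (A$2$2)"
  have z0: "z \<noteq> 0"
  proof
    assume "z = 0"
    then have "A$2$1 = 0" using assms(2) by (auto simp: z_def complex_eq_iff)
    with \<open>z = 0\<close> show False using assms(1) by (auto simp: z_def)
  qed
  have "Im ((of_int (A$1$1) * \<tau> + of_int (A$1$2)) * cnj z) =
      of_int (A$1$1 * A$2$2 - A$1$2 * A$2$1) * Im \<tau>"
    by (simp add: z_def algebra_simps)
  moreover have "real_of_int (A$1$1 * A$2$2 - A$1$2 * A$2$1) = 1"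
    using assms(1) by (simp only: SL2Z_simps of_int_1)
  ultimately have "Im ((of_int (A$1$1) * \<tau> + of_int (A$1$2)) * cnj z) = Im \<tau>" by simp
  then have "Im (moebius A \<tau>) = Im \<tau> / (cmod z)\<^sup>2"
    unfolding moebius_def z_def[symmetric] complex_div_cnj[of _ z] 
    by (metis Im_divide_of_real of_real_power)
  moreover have "of_real (Im \<tau> / (cmod z)\<^sup>2) powr s = 
      of_real (Im \<tau>) powr s / of_real (cmod z) powr (2 * s)"
  proof -
    have "of_real (Im \<tau> / (cmod z)\<^sup>2) powr s = exp (s * of_real (ln (Im \<tau> / (cmod z)\<^sup>2)))"
      using z0 assms by (simp add: powr_def flip: Ln_of_real)
    also have "ln (Im \<tau> / (cmod z)\<^sup>2) = ln (Im \<tau>) - 2 * ln (cmod z)"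
      using z0 assms by (simp add: ln_div ln_realpow)
    also have "exp (s * of_real \<dots>) = exp (s * of_real (ln (Im \<tau>))) / exp (2 * s * of_real (ln (cmod z)))"
      by (simp add: exp_diff [symmetric] algebra_simps)
    also have "\<dots> = of_real (Im \<tau>) powr s / of_real (cmod z) powr (2 * s)"
      using z0 assms by (simp add: powr_def Ln_of_real)
    finally show ?thesis .
  qed
  ultimately show ?thesis
    by (simp add: j_factor_def eis_term_def row_mul_def power_int_minus_divide flip: z_def)
qed

section \<open>Reduction of rows modulo the level\<close>

lemma red_vec_eq_iff:
  "red_vec N v = red_vec N w \<longleftrightarrow> int N dvd fst v - fst w \<and> int N dvd snd v - snd w"
  by (simp add: red_vec_def mod_eq_dvd_iff)

lemma red_vec_red_vec [simp]: "red_vec N (red_vec N v) = red_vec N v"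
  by (simp add: red_vec_def)

lemma red_vec_uminus_red_vec [simp]: "red_vec N (- red_vec N v) = red_vec N (- v)"
  by (simp add: red_vec_def mod_minus_eq)

lemma neg_vec_eq: "neg_vec N v = red_vec N (- v)"
  by (simp add: neg_vec_def uminus_prod_def)

lemma red_vec_row_mul [simp]: "red_vec N (red_vec N v \<star> A) = red_vec N (v \<star> A)"
proof -
  have "(a mod int N * x + b mod int N * y) mod int N = (a * x + b * y) mod int N" for a b x y
    by (metis mod_add_eq mod_mult_left_eq)
  then show ?thesis by (simp add: red_vec_def row_mul_def)
qed

lemma red_vec_row_mul_cong: 
  "red_vec N v = red_vec N w \<Longrightarrow> red_vec N (v \<star> A) = red_vec N (w \<star> A)"
  by (metis red_vec_row_mul)

lemma vec_act_eq: "vec_act N A v = red_vec N (v \<star> A)"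
  by (simp add: vec_act_def row_mul_def)

text \<open>Testing on the two unit rows recovers the entries. In this form closure under products, inverses and conjugation is immediate.\<close>

lemma principal_congruence_iff:
  "A \<in> principal_congruence N \<longleftrightarrow> A \<in> carrier SL2Z \<and> (\<forall>v. red_vec N (v \<star> A) = red_vec N v)"
proof (intro iffI conjI allI)
  fix v assume A: "A \<in> principal_congruence N"
  then have "A$1$1 mod int N = 1 mod int N" "A$1$2 mod int N = 0" 
    "A$2$1 mod int N = 0" "A$2$2 mod int N = 1 mod int N"
    by (auto simp: principal_congruence_def forall_2)
  then have "(a * A$1$1 + b * A$2$1) mod int N = a mod int N" 
    "(a * A$1$2 + b * A$2$2) mod int N = b mod int N" for a b
    by (metis (no_types) mod_add_eq mod_mult_right_eq mult.right_neutral mult_zero_right 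
          add.right_neutral add.left_neutral mod_0)+
  then show "red_vec N (v \<star> A) = red_vec N v"
    by (simp add: red_vec_def row_mul_def)
next
  assume A: "A \<in> carrier SL2Z \<and> (\<forall>v. red_vec N (v \<star> A) = red_vec N v)"
  then have "red_vec N ((1, 0) \<star> A) = red_vec N (1, 0)" "red_vec N ((0, 1) \<star> A) = red_vec N (0, 1)"
    by blast+
  then show "A \<in> principal_congruence N"
    using A by (simp add: principal_congruence_def forall_2 red_vec_def row_mul_def)
qed (auto simp: principal_congruence_def)

lemma subgroup_principal_congruence: "subgroup (principal_congruence N) SL2Z"
proof (rule SL.subgroupI)
  show "principal_congruence N \<subseteq> carrier SL2Z" by (auto simp: principal_congruence_iff)
  have "mat 1 \<in> principal_congruence N" by (simp add: principal_congruence_iff)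
  then show "principal_congruence N \<noteq> {}" by blast
next
  fix A assume A: "A \<in> principal_congruence N"
  then have A': "A \<in> carrier SL2Z" by (auto simp: principal_congruence_iff)
  have "red_vec N (v \<star> inv\<^bsub>SL2Z\<^esub> A) = red_vec N v" for v
    using A row_mul_inv(1)[OF A', of v] by (metis principal_congruence_iff)
  then show "inv\<^bsub>SL2Z\<^esub> A \<in> principal_congruence N"
    unfolding principal_congruence_iff using SL.inv_closed[OF A'] by blast
next
  fix A B assume AB: "A \<in> principal_congruence N" "B \<in> principal_congruence N"
  then have "A \<otimes>\<^bsub>SL2Z\<^esub> B \<in> carrier SL2Z" by (intro SL.m_closed) (auto simp only: principal_congruence_iff)
  then show "A \<otimes>\<^bsub>SL2Z\<^esub> B \<in> principal_congruence N"
    using AB unfolding principal_congruence_iff SL2Z_simps(2) row_mul_mult by metis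
qed

text \<open>By conjugation inside the modular group it suffices to move \<open>(0, 1)\<close> to a primitive row \<open>(c, d)\<close> congruent to it. A Bezout completion has diagonal entries congruent to one, and adding a multiple of the bottom row to the top row clears the remaining entry modulo \<open>N\<close>.\<close>

lemma principal_congruence_transitive:
  assumes "prim v" "prim w" "red_vec N v = red_vec N w"
  shows "\<exists>\<gamma>\<in>principal_congruence N. v \<star> \<gamma> = w"
proof -
  have "prim (0, 1)" by (simp add: prim_def)
  then obtain A where A: "A \<in> carrier SL2Z" and v: "(0, 1) \<star> A = v"
    using prim_transitive assms(1) by blast
  define w' where "w' = w \<star> inv\<^bsub>SL2Z\<^esub> A"
  have "prim w'" using assms(2) A by (simp only: w'_def prim_row_mul SL.inv_closed)
  have "red_vec N w' = red_vec N (0, 1)"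
    using red_vec_row_mul_cong[OF assms(3), of "inv\<^bsub>SL2Z\<^esub> A"] row_mul_inv(2)[OF A, of "(0, 1)"] 
    by (simp add: w'_def v)
  moreover obtain c d where w': "w' = (c, d)" by fastforce
  ultimately have c: "int N dvd c" and d: "int N dvd d - 1" by (simp_all add: red_vec_eq_iff)
  obtain p q where pq: "p * d + q * c = 1"
    using \<open>prim w'\<close> w' bezout_int[of d c] by (auto simp: prim_def coprime_iff_gcd_eq_1 gcd.commute)
  \<comment> \<open>The top row of the Bezout completion is \<open>(p, -q)\<close>; adding \<open>q\<close> times the bottom row makes it congruent to \<open>(1, 0)\<close>.\<close>
  let ?B = "vector [vector [p + q * c, - q + q * d], vector [c, d]] :: int^2^2"
  have "?B \<in> carrier SL2Z" using pq by (simp add: algebra_simps)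
  have p: "int N dvd p - 1"
  proof -
    have "p - 1 = - p * (d - 1) - q * c" using pq by (simp add: algebra_simps)
    then show ?thesis using c d by (metis dvd_diff dvd_mult)
  qed
  have "red_vec N (e \<star> ?B) = red_vec N e" for e
  proof -
    have "fst (e \<star> ?B) - fst e = fst e * (p - 1) + (fst e * q + snd e) * c"
      "snd (e \<star> ?B) - snd e = (fst e * q + snd e) * (d - 1)"
      by (simp_all add: row_mul_def algebra_simps)
    then show ?thesis using c d p by (simp add: red_vec_eq_iff)
  qed
  then have B: "?B \<in> principal_congruence N"
    using \<open>?B \<in> carrier SL2Z\<close> by (simp only: principal_congruence_iff) simp
  define C where "C = inv\<^bsub>SL2Z\<^esub> A ** ?B ** A"
  have act: "u \<star> C = u \<star> inv\<^bsub>SL2Z\<^esub> A \<star> ?B \<star> A" for u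
    by (simp only: C_def row_mul_mult)
  have "C \<in> carrier SL2Z" 
    unfolding C_def using SL.m_closed[OF SL.m_closed[OF SL.inv_closed[OF A] \<open>?B \<in> carrier SL2Z\<close>] A] 
    by (simp only: SL2Z_simps(2))
  moreover have "red_vec N (u \<star> C) = red_vec N u" for u
  proof -
    have "red_vec N (u \<star> inv\<^bsub>SL2Z\<^esub> A \<star> ?B) = red_vec N (u \<star> inv\<^bsub>SL2Z\<^esub> A)"
      using B by (simp only: principal_congruence_iff) 
    from red_vec_row_mul_cong[OF this, of A] show ?thesis
      by (simp only: act row_mul_inv(1)[OF A])
  qed
  moreover have "v \<star> C = w"
  proof -
    have "v \<star> inv\<^bsub>SL2Z\<^esub> A = (0, 1)" using row_mul_inv(2)[OF A, of "(0, 1)"] by (simp only: v)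
    then have "v \<star> C = (0, 1) \<star> ?B \<star> A" by (simp only: act)
    also have "(0, 1) \<star> ?B = w'" by (simp add: row_mul_def w')
    finally show ?thesis by (simp only: w'_def row_mul_inv(1)[OF A])
  qed
  ultimately show ?thesis by (metis principal_congruence_iff)
qed

section \<open>Vectors of additive order \<open>N\<close>\<close>

text \<open>Take for \<open>t\<close> the product of the primes that divide \<open>b\<close> but not \<open>a\<close>: each prime divisor of \<open>b\<close> then divides exactly one of \<open>a\<close> and \<open>t m\<close>.\<close>

lemma coprime_lift:
  fixes a b m :: int
  assumes "b \<noteq> 0" "coprime (gcd a b) m"
  shows "\<exists>t. coprime (a + t * m) b"
proof
  define t where "t = \<Prod>{p \<in> prime_factors b. \<not> p dvd a}"
  show "coprime (a + t * m) b"
  proof (rule ccontr)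
    assume "\<not> coprime (a + t * m) b"
    then have "\<not> is_unit (gcd (a + t * m) b)" "gcd (a + t * m) b \<noteq> 0"
      using assms(1) by (auto simp: coprime_iff_gcd_eq_1)
    then obtain p where p: "normalization_semidom_class.prime p" "p dvd a + t * m" "p dvd b"
      using prime_divisor_exists[of "gcd (a + t * m) b"] by auto
    show False
    proof (cases "p dvd a")
      case True
      have "\<not> p dvd t"
      proof
        assume "p dvd t"
        then obtain q where q: "q \<in> prime_factors b" "\<not> q dvd a" "p dvd q"
          using p(1) by (auto simp: t_def prime_dvd_prod_iff)
        then have "p = q" using p(1) by (auto intro: primes_dvd_imp_eq)
        with q True show False by simp
      qed
      moreover have "p dvd t * m" using p(2) True by (simp add: dvd_add_right_iff)
      ultimately have "p dvd m" using p(1) prime_dvd_mult_iff by blast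
      then have "is_unit p" using True p(3) assms(2) by (meson coprime_common_divisor gcd_greatest)
      then show False using p(1) by auto
    next
      case False
      then have "p \<in> {p \<in> prime_factors b. \<not> p dvd a}" using p assms(1) by (simp add: prime_factors_dvd)
      then have "p dvd t" unfolding t_def by (intro dvd_prodI) auto
      then show False using False p(2) by (simp add: dvd_add_left_iff)
    qed
  qed
qed

text \<open>The order of a residue pair is \<open>N\<close> iff its entries and \<open>N\<close> have no common factor, and such a pair lifts to a primitive row.\<close>

lemma Lam_eq:
  assumes "N \<ge> 1"
  shows "Lam N = red_vec N ` {w. prim w}"
proof -
  define K where "K = integer_mod_group N \<times>\<times> integer_mod_group N"
  interpret K: group K unfolding K_def by (intro DirProd_group group_integer_mod_group)
  have "a mod int N = a \<longleftrightarrow> a \<in> {0..<int N}" for a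
    using assms pos_mod_sign[of "int N" a] pos_mod_bound[of "int N" a]
    by (cases "a mod int N = a") (auto simp: mod_pos_pos_trivial)
  then have carrier: "v \<in> carrier K \<longleftrightarrow> red_vec N v = v" for v
    using assms by (cases v) (simp add: K_def DirProd_def carrier_integer_mod_group red_vec_def)
  have pow: "v [^]\<^bsub>K\<^esub> n = red_vec N (int n * fst v, int n * snd v)" for v and n :: nat
  proof (induction n)
    case 0
    then show ?case by (simp add: K_def DirProd_def red_vec_def)
  next
    case (Suc n)
    then show ?case by (simp add: K_def DirProd_def red_vec_def split_beta distrib_right add.commute
          mod_add_right_eq)
  qed
  have one: "\<one>\<^bsub>K\<^esub> = (0, 0)" by (simp add: K_def DirProd_def)
  have dvd: "group.ord K (red_vec N w) dvd n \<longleftrightarrow> int N dvd int n * fst w \<and> int N dvd int n * snd w" for w n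
    using K.pow_eq_id[of "red_vec N w" n] carrier[of "red_vec N w"] pow[of "red_vec N w" n]
    by (simp add: one red_vec_def mod_simps mod_eq_0_iff_dvd)
  have "v \<in> Lam N \<longleftrightarrow> (\<exists>w. prim w \<and> v = red_vec N w)" for v
  proof
    assume "v \<in> Lam N"
    then have v: "red_vec N v = v" and ord: "group.ord K v = N"
      unfolding Lam_def K_def[symmetric] by (auto simp: carrier)
    obtain a b where ab: "v = (a, b)" by fastforce
    define g where "g = gcd (gcd a b) (int N)"
    have "g > 0" using assms unfolding g_def by (intro gcd_pos_int[THEN iffD2]) auto
    have "g dvd a" "g dvd b" "g dvd int N" unfolding g_def by (meson dvd_trans gcd_dvd1 gcd_dvd2)+
    then obtain a' b' m where g: "a = g * a'" "b = g * b'" "int N = g * m" by (elim dvdE)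
    have "0 < g * m" using assms g(3) by linarith
    then have "m > 0" using \<open>g > 0\<close> by (simp add: zero_less_mult_iff)
    have "group.ord K (red_vec N v) dvd nat m"
      unfolding dvd using g ab \<open>m > 0\<close> by simp
    then have "int N dvd int (nat m)" unfolding int_dvd_int_iff using ord v by simp
    moreover have "int (nat m) = m" using \<open>m > 0\<close> by simp
    ultimately have "int N dvd m" by metis
    then have "g dvd 1" using g(3) \<open>m > 0\<close> by auto
    then have "g = 1" using \<open>g > 0\<close> by simp
    then have "coprime (gcd a b) (int N)" unfolding g_def coprime_iff_gcd_eq_1 .
    moreover have "gcd (gcd a (b + int N)) (int N) = gcd (gcd a b) (int N)" by (simp add: gcd.assoc)
    ultimately have "coprime (gcd a (b + int N)) (int N)" by (simp only: coprime_iff_gcd_eq_1)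
    \<comment> \<open>Shifting \<open>b\<close> by \<open>N\<close> excludes zero, for which no \<open>t\<close> need exist.\<close>
    moreover have "b + int N \<noteq> 0" 
    proof -
      have "b \<ge> 0" using v ab assms pos_mod_sign[of "int N" b] by (auto simp: red_vec_def) 
      then show ?thesis using assms by auto
    qed
    ultimately obtain t where "coprime (a + t * int N) (b + int N)"
      using coprime_lift by blast
    moreover have "v = red_vec N (a + t * int N, b + int N)"
      using v ab by (simp add: red_vec_def)
    ultimately show "\<exists>w. prim w \<and> v = red_vec N w" by (auto simp: prim_def)
  next
    assume "\<exists>w. prim w \<and> v = red_vec N w"
    then obtain w where w: "prim w" "v = red_vec N w" by blast
    let ?o = "group.ord K (red_vec N w)"
    have "?o dvd N" by (simp add: dvd)
    moreover have "int N dvd int ?o * fst w" "int N dvd int ?o * snd w"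
      using dvd[of w ?o] by auto
    then have "int N dvd gcd (int ?o * fst w) (int ?o * snd w)" by simp
    then have "N dvd ?o" using w(1) by (simp add: gcd_mult_distrib_int[symmetric] prim_def coprime_iff_gcd_eq_1)
    ultimately have "?o = N" by (rule dvd_antisym)
    then show "v \<in> Lam N" using w carrier[of v] unfolding Lam_def K_def[symmetric] by simp
  qed
  then show ?thesis by auto
qed

lemma red_vec_Lam: "N \<ge> 1 \<Longrightarrow> prim w \<Longrightarrow> red_vec N w \<in> Lam N"
  by (simp add: Lam_eq)

lemma Lam_neg: "N \<ge> 1 \<Longrightarrow> v \<in> Lam N \<Longrightarrow> neg_vec N v \<in> Lam N"
proof -
  assume N: "N \<ge> 1" and "v \<in> Lam N"
  then obtain w where "prim w" "v = red_vec N w" by (auto simp: Lam_eq)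
  then have "prim (- w)" "neg_vec N v = red_vec N (- w)" by (simp_all add: neg_vec_eq)
  then show "neg_vec N v \<in> Lam N" unfolding Lam_eq[OF N] by blast
qed

lemma neg_vec_neg_vec: "N \<ge> 1 \<Longrightarrow> v \<in> Lam N \<Longrightarrow> neg_vec N (neg_vec N v) = v"
  by (auto simp: Lam_eq neg_vec_eq)

lemma red_vec_uminus_eq_iff:
  assumes "prim w"
  shows "red_vec N (- w) = red_vec N w \<longleftrightarrow> N dvd 2"
proof -
  have "red_vec N (- w) = red_vec N w \<longleftrightarrow> int N dvd 2 * fst w \<and> int N dvd 2 * snd w"
  proof -
    have "fst (- w) - fst w = - (2 * fst w)" "snd (- w) - snd w = - (2 * snd w)" by simp_all
    then show ?thesis by (simp only: red_vec_eq_iff dvd_minus_iff)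
  qed
  also have "\<dots> \<longleftrightarrow> int N dvd gcd (2 * fst w) (2 * snd w)" by simp
  also have "gcd (2 * fst w) (2 * snd w) = 2"
    using assms gcd_mult_distrib_int[of 2 "fst w" "snd w"] by (simp add: prim_def coprime_iff_gcd_eq_1)
  also have "int N dvd 2 \<longleftrightarrow> N dvd 2" 
    using int_dvd_int_iff[of N 2] by simp
  finally show ?thesis .
qed

lemma finite_Lam: "N \<ge> 1 \<Longrightarrow> finite (Lam N)"
proof -
  assume N: "N \<ge> 1"
  have "Lam N \<subseteq> {0..<int N} \<times> {0..<int N}"
    unfolding Lam_eq[OF N] using N by (auto simp: red_vec_def)
  then show ?thesis by (rule finite_subset) simp
qed

lemma Pi_pm_eq_iff:
  assumes "N \<ge> 1" "v \<in> Lam N" "w \<in> Lam N"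
  shows "Pi_pm N v = Pi_pm N w \<longleftrightarrow> v = w \<or> v = neg_vec N w"
  using neg_vec_neg_vec[OF assms(1,2)] neg_vec_neg_vec[OF assms(1,3)] 
  by (auto simp: Pi_pm_def doubleton_eq_iff)

lemma Pi_pm_uminus [simp]: "Pi_pm N (red_vec N (- w)) = Pi_pm N (red_vec N w)"
  by (auto simp: Pi_pm_def neg_vec_eq)

section \<open>Orbits of rows under a congruence subgroup\<close>

definition row_orbit :: "(int^2^2) set \<Rightarrow> int \<times> int \<Rightarrow> (int \<times> int) set" where
  "row_orbit G u = (\<lambda>\<gamma>. u \<star> \<gamma>) ` G"

lemma row_orbit_uminus: "row_orbit G (- u) = uminus ` row_orbit G u"
  by (simp add: row_orbit_def image_image)

locale congruence_subgroup =
  fixes N :: nat and G :: "(int^2^2) set"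
  assumes level_pos: "N \<ge> 1" and subgroup: "subgroup G SL2Z"
    and level: "principal_congruence N \<subseteq> G"
begin

lemma G_SL2Z: "\<gamma> \<in> G \<Longrightarrow> \<gamma> \<in> carrier SL2Z"
  using subgroup.subset[OF subgroup] by blast

lemma G_mult: "\<gamma> \<in> G \<Longrightarrow> \<delta> \<in> G \<Longrightarrow> \<gamma> ** \<delta> \<in> G"
  using subgroup.m_closed[OF subgroup] by simp

lemma G_inv: "\<gamma> \<in> G \<Longrightarrow> inv\<^bsub>SL2Z\<^esub> \<gamma> \<in> G"
  using subgroup.m_inv_closed[OF subgroup] by simp

lemma G_one: "mat 1 \<in> G"
  using subgroup.one_closed[OF subgroup] by simp

lemma prim_row_orbit: "prim u \<Longrightarrow> w \<in> row_orbit G u \<Longrightarrow> prim w"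
  by (auto simp only: row_orbit_def image_iff prim_row_mul G_SL2Z)

lemma row_orbit_self: "u \<in> row_orbit G u"
  unfolding row_orbit_def using G_one by (metis imageI row_mul_one)

lemma row_orbit_trans: "w \<in> row_orbit G v \<Longrightarrow> v \<in> row_orbit G u \<Longrightarrow> w \<in> row_orbit G u"
  unfolding row_orbit_def using G_mult by (auto simp flip: row_mul_mult)

lemma row_orbit_sym: "v \<in> row_orbit G u \<Longrightarrow> u \<in> row_orbit G v"
proof -
  assume "v \<in> row_orbit G u"
  then obtain \<gamma> where "\<gamma> \<in> G" "v = u \<star> \<gamma>" by (auto simp: row_orbit_def)
  then have "u = v \<star> inv\<^bsub>SL2Z\<^esub> \<gamma>" using row_mul_inv(2)[OF G_SL2Z] by simp
  then show ?thesis using G_inv[OF \<open>\<gamma> \<in> G\<close>] by (auto simp: row_orbit_def)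
qed

text \<open>Since \<open>\<Gamma>(N) \<subseteq> G\<close> is transitive on the primitive rows in a residue class, an orbit of primitive rows consists of full residue classes.\<close>

lemma row_orbit_iff:
  assumes "prim u"
  shows "w \<in> row_orbit G u \<longleftrightarrow> prim w \<and> red_vec N w \<in> red_vec N ` row_orbit G u"
proof (intro iffI conjI)
  assume "prim w \<and> red_vec N w \<in> red_vec N ` row_orbit G u"
  then obtain v where v: "prim w" "v \<in> row_orbit G u" "red_vec N v = red_vec N w" by auto
  moreover have "prim v" using prim_row_orbit[OF assms v(2)] .
  ultimately obtain \<gamma> where \<gamma>: "\<gamma> \<in> principal_congruence N" "v \<star> \<gamma> = w"
    using principal_congruence_transitive by blast
  then have "w \<in> row_orbit G v" using level by (auto simp: row_orbit_def)
  then show "w \<in> row_orbit G u" using v row_orbit_trans by blast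
qed (use prim_row_orbit[OF assms] in auto)

lemma orbit_vec_act:
  "orbit (grp G) (vec_act N) (red_vec N u) = red_vec N ` row_orbit G u"
  by (auto simp: orbit_def vec_act_eq row_orbit_def)

lemma red_row_orbit_Lam: "prim u \<Longrightarrow> red_vec N ` row_orbit G u \<subseteq> Lam N"
  unfolding Lam_eq[OF level_pos] using prim_row_orbit by blast

lemma red_row_orbit_uminus: 
  "red_vec N ` row_orbit G (- u) = neg_vec N ` red_vec N ` row_orbit G u"
  by (simp add: row_orbit_uminus image_image neg_vec_eq)

lemma red_row_orbit_disjoint:
  assumes "prim u" "- u \<notin> row_orbit G u"
  shows "red_vec N ` row_orbit G u \<inter> neg_vec N ` red_vec N ` row_orbit G u = {}"
proof (rule ccontr)
  assume "\<not> ?thesis"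
  then obtain v where v: "v \<in> red_vec N ` row_orbit G u" "v \<in> red_vec N ` row_orbit G (- u)"
    unfolding red_row_orbit_uminus[symmetric] by blast
  obtain w where w: "v = red_vec N w" "w \<in> row_orbit G (- u)" using v(2) by (rule imageE)
  then have "w \<in> row_orbit G u"
    using row_orbit_iff[OF assms(1), of w] prim_row_orbit[of "- u" w] assms(1) v(1) by simp
  moreover have "- u \<in> row_orbit G w" using w(2) by (rule row_orbit_sym)
  ultimately show False using assms(2) row_orbit_trans by blast
qed

end

section \<open>Cusps of the principal congruence subgroup\<close>

lemma moebius_rat_pole_inv:
  assumes "A \<in> carrier SL2Z" "prim v"
  shows "moebius_rat A (pole v) = pole (v \<star> inv\<^bsub>SL2Z\<^esub> A)"
proof -
  have "v \<star> inv\<^bsub>SL2Z\<^esub> A \<noteq> 0"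
    using assms by (intro prim_nonzero) (simp only: prim_row_mul SL.inv_closed)
  from moebius_rat_pole[OF assms(1) this] show ?thesis by (simp only: row_mul_inv(1)[OF assms(1)])
qed

lemma image_inv_subgroup:
  assumes "subgroup H SL2Z"
  shows "m_inv SL2Z ` H = H"
proof
  show "m_inv SL2Z ` H \<subseteq> H" using subgroup.m_inv_closed[OF assms] by blast
  show "H \<subseteq> m_inv SL2Z ` H"
    using subgroup.m_inv_closed[OF assms] subgroup.mem_carrier[OF assms] SL.inv_inv
    by (metis image_eqI subsetI)
qed

lemma cusp_class_pole:
  assumes "subgroup H SL2Z" "prim u"
  shows "cusp_class H (pole u) = pole ` row_orbit H u"
proof -
  have "cusp_class H (pole u) = (\<lambda>g. moebius_rat g (pole u)) ` H"
    by (auto simp: cusp_class_def orbit_def)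
  also have "\<dots> = (\<lambda>g. pole (u \<star> g)) ` m_inv SL2Z ` H"
    unfolding image_image using moebius_rat_pole_inv[OF _ assms(2)] subgroup.mem_carrier[OF assms(1)]
    by (intro image_cong) auto
  finally show ?thesis unfolding image_inv_subgroup[OF assms(1)] row_orbit_def image_image .
qed

context congruence_subgroup
begin

text \<open>Changing the point inside its cusp changes the row by an element of \<open>\<Gamma>(N)\<close>, which is invisible modulo \<open>N\<close>, and by a sign, which is invisible in \<open>Pi_pm\<close>.\<close>

lemma phi_cusp_class:
  assumes "prim u"
  shows "phi N (cusp_class (principal_congruence N) (pole u)) = Pi_pm N (red_vec N u)"
proof -
  let ?C = "cusp_class (principal_congruence N) (pole u)"
  have C: "?C = pole ` row_orbit (principal_congruence N) u"
    by (rule cusp_class_pole[OF subgroup_principal_congruence assms])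
  have "mat 1 \<in> principal_congruence N" by (simp add: principal_congruence_iff)
  then have "?C \<noteq> {}" unfolding C row_orbit_def by blast
  then have "(SOME x. x \<in> ?C) \<in> ?C" by (simp add: some_in_eq)
  then obtain \<gamma> where \<gamma>: "\<gamma> \<in> principal_congruence N" "(SOME x. x \<in> ?C) = pole (u \<star> \<gamma>)"
    by (auto simp: C row_orbit_def)
  have "prim (u \<star> \<gamma>)" using \<gamma>(1) assms by (simp only: principal_congruence_iff prim_row_mul)
  then have "cusp_vec (pole (u \<star> \<gamma>)) = u \<star> \<gamma> \<or> cusp_vec (pole (u \<star> \<gamma>)) = - (u \<star> \<gamma>)"
    using pole_eq_iff[OF _ prim_cusp_vec, of "u \<star> \<gamma>" "pole (u \<star> \<gamma>)"] pole_cusp_vec by simp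
  moreover have "red_vec N (u \<star> \<gamma>) = red_vec N u" using \<gamma>(1) by (simp only: principal_congruence_iff)
  ultimately show ?thesis unfolding phi_def \<gamma>(2) by auto
qed

lemma or_cusps_eq:
  assumes "prim u"
  shows "or_cusps G N (pole u) = (\<lambda>w. cusp_class (principal_congruence N) (pole w)) ` row_orbit G u"
proof -
  have "or_cusps G N (pole u) = cusp_class (principal_congruence N) ` cusp_class G (pole u)"
    by (auto simp: or_cusps_def cusp_class_def[of G] orbit_def)
  then show ?thesis by (simp add: cusp_class_pole[OF subgroup assms] image_image)
qed

text \<open>The injectivity of \<open>\<phi>\<^sub>N\<close>: congruent primitive rows are equivalent under \<open>\<Gamma>(N)\<close>, and opposite rows have the same pole.\<close>

lemma cusp_class_eqI:
  assumes "prim v" "prim w" "Pi_pm N (red_vec N v) = Pi_pm N (red_vec N w)"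
  shows "cusp_class (principal_congruence N) (pole v) = cusp_class (principal_congruence N) (pole w)"
proof -
  interpret Gam: congruence_subgroup N "principal_congruence N"
    by (rule congruence_subgroup.intro[OF level_pos subgroup_principal_congruence subset_refl])
  have *: "cusp_class (principal_congruence N) (pole v) = cusp_class (principal_congruence N) (pole w)"
    if w: "prim w" "red_vec N v = red_vec N w" for w
  proof -
    obtain \<gamma> where "\<gamma> \<in> principal_congruence N" "v \<star> \<gamma> = w"
      using principal_congruence_transitive assms(1) w by blast
    then have "w \<in> row_orbit (principal_congruence N) v" by (auto simp: row_orbit_def)
    then have "row_orbit (principal_congruence N) v = row_orbit (principal_congruence N) w"
      using Gam.row_orbit_trans Gam.row_orbit_sym by blast
    then show ?thesis
      using assms(1) w(1) by (simp add: cusp_class_pole[OF subgroup_principal_congruence])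
  qed
  have "red_vec N v \<in> Lam N" "red_vec N w \<in> Lam N" using assms by (auto simp: Lam_eq[OF level_pos])
  then have "red_vec N v = red_vec N w \<or> red_vec N v = red_vec N (- w)"
    using Pi_pm_eq_iff[OF level_pos] assms(3) by (auto simp: neg_vec_eq)
  then show ?thesis using *[of w] *[of "- w"] assms(2) by auto
qed

lemma phi_inj: 
  assumes "prim u"
  shows "inj_on (phi N) (or_cusps G N (pole u))"
proof (rule inj_onI)
  fix y y' assume "y \<in> or_cusps G N (pole u)" "y' \<in> or_cusps G N (pole u)"
  then obtain v w where "prim v" "prim w" 
    and y: "y = cusp_class (principal_congruence N) (pole v)" 
    and y': "y' = cusp_class (principal_congruence N) (pole w)"
    unfolding or_cusps_eq[OF assms] using prim_row_orbit[OF assms] by blast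
  moreover assume "phi N y = phi N y'"
  ultimately show "y = y'" unfolding y y' using cusp_class_eqI phi_cusp_class by metis
qed

lemma phi_image:
  assumes "prim u"
  shows "phi N ` or_cusps G N (pole u) = Pi_pm N ` red_vec N ` row_orbit G u"
  unfolding or_cusps_eq[OF assms] image_image
  using phi_cusp_class prim_row_orbit[OF assms] by (intro image_cong) auto

end

declare SL2Z_simps(1) [simp del]

section \<open>Stabilizers of cusps and irregularity\<close>

text \<open>The matrix \<open>e T\<^sup>t\<close> for a sign \<open>e\<close>. With \<open>e * t\<close> in the corner, signs multiply and exponents add.\<close>

definition trans_mat :: "int \<Rightarrow> int \<Rightarrow> int^2^2" where
  "trans_mat e t = vector [vector [e, e * t], vector [0, e]]"

lemma trans_mat_mult: "trans_mat e t ** trans_mat e' t' = trans_mat (e * e') (t + t')"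
  by (simp add: trans_mat_def mat_eq_iff_2x2 algebra_simps)

lemma trans_mat_SL2Z: "e = 1 \<or> e = - 1 \<Longrightarrow> trans_mat e t \<in> carrier SL2Z"
  by (auto simp: trans_mat_def SL2Z_simps(1))

lemma trans_mat_0: "trans_mat 1 0 = mat 1" "trans_mat (- 1) 0 = - mat 1"
  by (simp_all add: trans_mat_def mat_eq_iff_2x2)

lemma inv_trans_mat: 
  assumes "e = 1 \<or> e = - 1"
  shows "inv\<^bsub>SL2Z\<^esub> trans_mat e t = trans_mat e (- t)"
  by (rule SL.inv_equality) (use assms in \<open>auto simp: trans_mat_mult trans_mat_0 trans_mat_SL2Z\<close>)

lemma minus_T_power: "- (T_mat [^]\<^bsub>SL2Z\<^esub> (h :: nat)) = trans_mat (- 1) (int h)"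
proof -
  have "trans_mat 1 1 [^]\<^bsub>SL2Z\<^esub> h = trans_mat 1 (int h)"
    by (induction h) (simp_all add: trans_mat_0 trans_mat_mult add.commute)
  moreover have "T_mat = trans_mat 1 1" by (simp add: T_mat_def trans_mat_def)
  ultimately have "T_mat [^]\<^bsub>SL2Z\<^esub> h = trans_mat 1 (int h)" by simp
  then show ?thesis by (simp add: trans_mat_def mat_eq_iff_2x2)
qed

lemma row_mul_pm_eq_trans_mat:
  assumes "A \<in> carrier SL2Z" "(0, 1) \<star> A = (0, 1) \<or> (0, 1) \<star> A = - (0, 1)"
  obtains e t where "e = 1 \<or> e = - 1" "A = trans_mat e t"
proof
  show e: "A$1$1 = 1 \<or> A$1$1 = - 1"
    using assms by (auto simp: row_mul_def SL2Z_simps(1))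
  show "A = trans_mat (A$1$1) (A$1$1 * A$1$2)"
    using assms e by (auto simp: row_mul_def SL2Z_simps(1) trans_mat_def mat_eq_iff_2x2)
qed

lemma trans_mat_multiples:
  assumes "subgroup K SL2Z" "trans_mat e h \<in> K" "e = 1 \<or> e = - 1"
  shows "\<exists>e'. (e' = 1 \<or> e' = e) \<and> trans_mat e' (q * h) \<in> K"
proof (induction q rule: int_induct[where k = 0])
  case base
  then show ?case using subgroup.one_closed[OF assms(1)] by (auto simp: trans_mat_0)
next
  case (step1 i)
  then obtain e' where e': "e' = 1 \<or> e' = e" "trans_mat e' (i * h) \<in> K" by blast
  then have "trans_mat e' (i * h) \<otimes>\<^bsub>SL2Z\<^esub> trans_mat e h \<in> K" 
    by (intro subgroup.m_closed assms)
  then have "trans_mat (e' * e) ((i + 1) * h) \<in> K" by (simp add: trans_mat_mult algebra_simps)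
  moreover have "e' * e = 1 \<or> e' * e = e" using e' assms(3) by auto
  ultimately show ?case by blast
next
  case (step2 i)
  then obtain e' where e': "e' = 1 \<or> e' = e" "trans_mat e' (i * h) \<in> K" by blast
  then have "trans_mat e' (i * h) \<otimes>\<^bsub>SL2Z\<^esub> inv\<^bsub>SL2Z\<^esub> trans_mat e h \<in> K" 
    by (intro subgroup.m_closed subgroup.m_inv_closed assms)
  then have "trans_mat (e' * e) ((i - 1) * h) \<in> K" 
    by (simp add: inv_trans_mat[OF assms(3)] trans_mat_mult algebra_simps)
  moreover have "e' * e = 1 \<or> e' * e = e" using e' assms(3) by auto
  ultimately show ?case by blast
qed

text \<open>A subgroup \<open>K\<close> of \<open>{\<plusminus>T\<^sup>t}\<close> without \<open>-1\<close> contains at most one of \<open>T\<^sup>t\<close> and \<open>-T\<^sup>t\<close>, so it is infinite cyclic, generated by the element of least positive exponent \<open>h\<close>. If that element were \<open>T\<^sup>h\<close>, all of \<open>K\<close> would have positive sign, contrary to the presence of \<open>B\<close>.\<close>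

lemma subgroup_without_minus_one:
  assumes K: "subgroup K SL2Z" and "- mat 1 \<notin> K"
    and K_form: "\<And>A. A \<in> K \<Longrightarrow> (0, 1) \<star> A = (0, 1) \<or> (0, 1) \<star> A = - (0, 1)"
    and neg: "B \<in> K" "(0, 1) \<star> B = - (0, 1)"
  shows "\<exists>h::nat. h \<ge> 1 \<and> K = generate SL2Z {- (T_mat [^]\<^bsub>SL2Z\<^esub> h)}"
proof -
  have form: "\<exists>e t. (e = 1 \<or> e = - 1) \<and> A = trans_mat e t" if "A \<in> K" for A
    using row_mul_pm_eq_trans_mat[of A] K_form[OF that] subgroup.mem_carrier[OF K that] by metis
  have inv: "trans_mat e (- t) \<in> K" if "trans_mat e t \<in> K" "e = 1 \<or> e = - 1" for e t
    using subgroup.m_inv_closed[OF K that(1)] by (simp add: inv_trans_mat[OF that(2)])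
  have mult: "trans_mat (e * e') (t + t') \<in> K" if "trans_mat e t \<in> K" "trans_mat e' t' \<in> K" for e e' t t'
    using subgroup.m_closed[OF K that] by (simp add: trans_mat_mult)
  have sign: "e = e'" if "trans_mat e t \<in> K" "trans_mat e' t \<in> K" "e = 1 \<or> e = - 1" "e' = 1 \<or> e' = - 1" for e e' t
    using mult[OF that(1) inv[OF that(2,4)]] that(3,4) assms(2) trans_mat_0(2) by auto
  obtain t0 where t0: "trans_mat (- 1) t0 \<in> K"
  proof -
    obtain e t where "e = 1 \<or> e = - 1" "B = trans_mat e t" using form[OF neg(1)] by blast
    then have "B = trans_mat (- 1) t" using neg(2) by (auto simp: row_mul_def trans_mat_def)
    then show ?thesis using that neg(1) by blast
  qed
  have "t0 \<noteq> 0" using t0 assms(2) trans_mat_0(2) by auto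
  \<comment> \<open>The positive exponents that occur in \<open>K\<close> with either sign.\<close>
  define D where "D = (\<lambda>n :: nat. n > 0 \<and> (\<exists>e. (e = 1 \<or> e = - 1) \<and> trans_mat e (int n) \<in> K))"
  have "D (nat \<bar>t0\<bar>)" using t0 inv[OF t0] \<open>t0 \<noteq> 0\<close> unfolding D_def by (cases "t0 > 0") auto
  define h where "h = (LEAST n. D n)"
  have "D h" unfolding h_def using \<open>D (nat \<bar>t0\<bar>)\<close> by (rule LeastI)
  then obtain e where "h > 0" and e: "e = 1 \<or> e = - 1" "trans_mat e (int h) \<in> K"
    unfolding D_def by blast
  have multiple: "\<exists>q. t = q * int h" if t: "trans_mat e1 t \<in> K" "e1 = 1 \<or> e1 = - 1" for e1 t
  proof -
    obtain e2 where e2: "e2 = 1 \<or> e2 = e" "trans_mat e2 (- (t div int h) * int h) \<in> K"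
      using trans_mat_multiples[OF K e(2,1)] by metis
    have *: "t + - (t div int h) * int h = t mod int h" by (simp add: minus_div_mult_eq_mod)
    have "trans_mat (e1 * e2) (t mod int h) \<in> K" using mult[OF t(1) e2(2)] unfolding * .
    moreover have "int (nat (t mod int h)) = t mod int h" using \<open>h > 0\<close> by simp
    moreover have "e1 * e2 = 1 \<or> e1 * e2 = - 1" using t(2) e2(1) e(1) by auto
    moreover have "\<not> D (nat (t mod int h))"
    proof (rule not_less_Least)
      show "nat (t mod int h) < (LEAST n. D n)" 
        unfolding h_def[symmetric] using \<open>h > 0\<close> by (simp add: nat_less_iff)
    qed
    ultimately have "t mod int h = 0" unfolding D_def by (metis gr0I of_nat_0)
    then show ?thesis by (metis dvd_def mod_0_imp_dvd mult.commute)
  qed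
  \<comment> \<open>Otherwise \<open>T\<close> to the power \<open>t0\<close> would lie in \<open>K\<close> along with its negative.\<close>
  have "e = - 1"
  proof (rule ccontr)
    assume "e \<noteq> - 1"
    then have "trans_mat 1 (int h) \<in> K" using e by auto
    then have "trans_mat 1 t0 \<in> K" using multiple[OF t0] trans_mat_multiples[OF K, of 1 "int h"] by auto
    then show False using sign[of "- 1" t0 1] t0 by simp
  qed
  then have gen: "- (T_mat [^]\<^bsub>SL2Z\<^esub> h) \<in> K" using e(2) by (simp add: minus_T_power)
  define J where "J = generate SL2Z {- (T_mat [^]\<^bsub>SL2Z\<^esub> h)}"
  have J: "subgroup J SL2Z" unfolding J_def using subgroup.mem_carrier[OF K gen] 
    by (intro SL.generate_is_subgroup) auto
  have "J \<subseteq> K" unfolding J_def using K gen by (intro SL.generate_subgroup_incl) auto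
  have "trans_mat (- 1) (int h) \<in> J" unfolding J_def minus_T_power by (auto intro: generate.incl)
  have "K \<subseteq> J"
  proof
    fix A assume "A \<in> K"
    then obtain e1 t where A: "e1 = 1 \<or> e1 = - 1" "A = trans_mat e1 t" using form by blast
    then obtain q where "t = q * int h" using multiple \<open>A \<in> K\<close> by blast
    then obtain e2 where e2: "e2 = 1 \<or> e2 = - 1" "trans_mat e2 t \<in> J"
      using trans_mat_multiples[OF J \<open>trans_mat (- 1) (int h) \<in> J\<close>] by blast
    then show "A \<in> J" using sign[of e1 t e2] A \<open>A \<in> K\<close> \<open>J \<subseteq> K\<close> by auto
  qed
  then show ?thesis using \<open>J \<subseteq> K\<close> \<open>h > 0\<close> unfolding J_def by (intro exI[of _ h]) auto
qed

section \<open>Choosing rows up to sign\<close>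

text \<open>A set of representatives for the pairs \<open>{w, -w}\<close> that meet \<open>L\<close>. The representative need not lie in \<open>L\<close>.\<close>

definition sign_section :: "(int \<times> int) set \<Rightarrow> (int \<times> int) set \<Rightarrow> bool" where
  "sign_section S L \<longleftrightarrow> S \<subseteq> L \<union> uminus ` L \<and> (\<forall>w\<in>L. (w \<in> S) \<noteq> (- w \<in> S))"

lemma sign_sectionD:
  assumes "sign_section S L"
  shows "S \<subseteq> L \<union> uminus ` L" "w \<in> L \<Longrightarrow> (w \<in> S) \<noteq> (- w \<in> S)"
  using conjunct1[OF assms[unfolded sign_section_def]]
    bspec[OF conjunct2[OF assms[unfolded sign_section_def]]] by this

text \<open>The bijection between two sections changes the sign of a row where they disagree.\<close>

lemma infsum_sign_section:
  fixes f :: "int \<times> int \<Rightarrow> complex"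
  assumes S: "sign_section S L" and S': "sign_section S' L" and f: "\<And>w. f (- w) = f w"
  shows "infsum f S = infsum f S'"
proof -
  define h where "h T = (\<lambda>w :: int \<times> int. if w \<in> T then w else - w)" for T
  have in_or: "- w \<in> T" if "sign_section T L" "sign_section T' L" "w \<in> T'" "w \<notin> T" for T T' w
    using that unfolding sign_section_def by (metis (no_types) UnE imageE minus_minus subsetD)
  have notin: "- w \<notin> T" if "sign_section T L" "w \<in> T" for T w
    using that unfolding sign_section_def by (metis (no_types) UnE imageE minus_minus subsetD)
  have "bij_betw (h S') S S'"
    by (rule bij_betw_byWitness[where f' = "h S"])
       (use in_or[OF S' S] in_or[OF S S'] notin[OF S] notin[OF S'] in \<open>auto simp: h_def\<close>)
  then have "infsum f S' = infsum (\<lambda>w. f (h S' w)) S" by (rule infsum_reindex_bij_betw[symmetric])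
  also have "(\<lambda>w. f (h S' w)) = f" using f by (auto simp: h_def)
  finally show ?thesis by simp
qed

lemma sign_section_eq:
  assumes "sign_section S L" "S \<subseteq> L" "\<And>w. w \<in> L \<Longrightarrow> - w \<notin> L"
  shows "S = L"
  using assms unfolding sign_section_def by blast

context congruence_subgroup
begin

lemma uminus_notin_row_orbit:
  assumes "- u \<notin> row_orbit G u" "w \<in> row_orbit G u"
  shows "- w \<notin> row_orbit G u"
proof
  assume "- w \<in> row_orbit G u"
  moreover have "- u \<in> row_orbit G (- w)"
    using row_orbit_sym[OF assms(2)] by (simp add: row_orbit_uminus)
  ultimately show False using assms(1) row_orbit_trans by blast
qed

lemma cusp_stab_pole:
  assumes "prim u"
  shows "cusp_stab G (pole u) = {\<gamma> \<in> G. u \<star> \<gamma> = u \<or> u \<star> \<gamma> = - u}"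
proof -
  have "moebius_rat \<gamma> (pole u) = pole u \<longleftrightarrow> u \<star> \<gamma> = u \<or> u \<star> \<gamma> = - u" if "\<gamma> \<in> G" for \<gamma>
  proof -
    have \<gamma>: "\<gamma> \<in> carrier SL2Z" by (rule G_SL2Z[OF that])
    have "prim (u \<star> inv\<^bsub>SL2Z\<^esub> \<gamma>)" using prim_row_mul[OF SL.inv_closed[OF \<gamma>]] assms by simp
    then have "moebius_rat \<gamma> (pole u) = pole u \<longleftrightarrow> u \<star> inv\<^bsub>SL2Z\<^esub> \<gamma> = u \<or> u \<star> inv\<^bsub>SL2Z\<^esub> \<gamma> = - u"
      using moebius_rat_pole_inv[OF \<gamma> assms] pole_eq_iff[OF assms, of "u \<star> inv\<^bsub>SL2Z\<^esub> \<gamma>"] by metis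
    also have "\<dots> \<longleftrightarrow> u \<star> \<gamma> = u \<or> u \<star> \<gamma> = - u"
      using row_mul_inv[OF \<gamma>] by (metis row_mul_uminus minus_minus)
    finally show ?thesis .
  qed
  then show ?thesis by (auto simp: cusp_stab_def stabilizer_def)
qed

section \<open>The spectral Eisenstein series as a sum over rows\<close>

text \<open>A primitive row is determined by its pole up to sign, so the stabilizer of the pole of \<open>u\<close> consists of the elements that fix \<open>u\<close> up to sign.\<close>

lemma rcosets_cusp_stab:
  assumes "prim u"
  shows "rcosets\<^bsub>grp G\<^esub> (cusp_stab G (pole u)) =
    (\<lambda>\<gamma>. {\<delta> \<in> G. u \<star> \<delta> = u \<star> \<gamma> \<or> u \<star> \<delta> = - (u \<star> \<gamma>)}) ` G"
proof -
  have "cusp_stab G (pole u) #>\<^bsub>grp G\<^esub> \<gamma> = {\<delta> \<in> G. u \<star> \<delta> = u \<star> \<gamma> \<or> u \<star> \<delta> = - (u \<star> \<gamma>)}"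
    if \<gamma>: "\<gamma> \<in> G" for \<gamma>
  proof (intro equalityI subsetI)
    fix \<delta> assume "\<delta> \<in> cusp_stab G (pole u) #>\<^bsub>grp G\<^esub> \<gamma>"
    then obtain g where "g \<in> cusp_stab G (pole u)" "\<delta> = g ** \<gamma>" by (auto simp: r_coset_def)
    then show "\<delta> \<in> {\<delta> \<in> G. u \<star> \<delta> = u \<star> \<gamma> \<or> u \<star> \<delta> = - (u \<star> \<gamma>)}"
      using G_mult[OF _ \<gamma>] by (auto simp: cusp_stab_pole[OF assms] row_mul_mult)
  next
    fix \<delta> assume \<delta>: "\<delta> \<in> {\<delta> \<in> G. u \<star> \<delta> = u \<star> \<gamma> \<or> u \<star> \<delta> = - (u \<star> \<gamma>)}"
    define g where "g = \<delta> ** inv\<^bsub>SL2Z\<^esub> \<gamma>"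
    have "g \<in> G" unfolding g_def using \<delta> G_mult G_inv[OF \<gamma>] by blast
    moreover have "u \<star> g = u \<or> u \<star> g = - u"
      using \<delta> by (auto simp: g_def row_mul_mult row_mul_inv(2)[OF G_SL2Z[OF \<gamma>]])
    moreover have "\<delta> = g ** \<gamma>"
      using SL.l_inv[OF G_SL2Z[OF \<gamma>]] by (simp add: g_def matrix_mul_rid flip: matrix_mul_assoc)
    ultimately show "\<delta> \<in> cusp_stab G (pole u) #>\<^bsub>grp G\<^esub> \<gamma>"
      by (auto simp: r_coset_def cusp_stab_pole[OF assms])
  qed
  then show ?thesis by (auto simp: RCOSETS_def)
qed

text \<open>Each coset contributes the row of the element that is chosen in it, so the series runs over a set of rows that contains one of each pair \<open>\<plusminus>u\<gamma>\<close>. The section does not depend on \<open>k\<close>, \<open>s\<close> and \<open>\<tau>\<close>.\<close>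

lemma E_spectral_section:
  assumes "scaling_matrix x \<sigma>"
  shows "\<exists>S. sign_section S (row_orbit G (inv_row \<sigma>)) \<and> S \<subseteq> row_orbit G (inv_row \<sigma>) \<and>
    (\<forall>k s \<tau>. Im \<tau> > 0 \<longrightarrow> E_spectral G k x \<sigma> \<tau> s = infsum (eis_term k s \<tau>) S)"
proof -
  define u where "u = inv_row \<sigma>"
  have \<sigma>: "\<sigma> \<in> carrier SL2Z" and x: "x = pole u"
    using assms by (auto simp: scaling_matrix_iff u_def)
  have u: "prim u" unfolding u_def by (rule prim_inv_row[OF \<sigma>])
  define C where "C = (\<lambda>\<gamma>. {\<delta> \<in> G. u \<star> \<delta> = u \<star> \<gamma> \<or> u \<star> \<delta> = - (u \<star> \<gamma>)})"
  define f where "f = (\<lambda>D. u \<star> (SOME \<gamma>. \<gamma> \<in> D))"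
  have cosets: "rcosets\<^bsub>grp G\<^esub> (cusp_stab G x) = C ` G"
    unfolding x C_def by (rule rcosets_cusp_stab[OF u])
  have some: "(SOME \<delta>. \<delta> \<in> C \<gamma>) \<in> C \<gamma>" if "\<gamma> \<in> G" for \<gamma>
    by (rule someI[of "\<lambda>\<delta>. \<delta> \<in> C \<gamma>" \<gamma>]) (simp add: C_def that)
  have some_G: "(SOME \<delta>. \<delta> \<in> C \<gamma>) \<in> G" if "\<gamma> \<in> G" for \<gamma>
    using some[OF that] by (simp add: C_def)
  have f_C: "f (C \<gamma>) = u \<star> \<gamma> \<or> f (C \<gamma>) = - (u \<star> \<gamma>)" if "\<gamma> \<in> G" for \<gamma>
    using some[OF that] by (simp add: C_def f_def)
  have C_eq: "C \<gamma> = C \<delta>" if "u \<star> \<gamma> = u \<star> \<delta> \<or> u \<star> \<gamma> = - (u \<star> \<delta>)" for \<gamma> \<delta>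
    using that by (auto simp: C_def)
  have inj: "inj_on f (C ` G)"
  proof (rule inj_onI, elim imageE, hypsubst)
    fix \<gamma> \<delta> assume "\<gamma> \<in> G" "\<delta> \<in> G" "f (C \<gamma>) = f (C \<delta>)"
    then show "C \<gamma> = C \<delta>" using f_C[of \<gamma>] f_C[of \<delta>] by (intro C_eq) auto
  qed
  define S where "S = f ` C ` G"
  have sub: "S \<subseteq> row_orbit G u" using some_G by (auto simp: S_def f_def row_orbit_def)
  have sec: "sign_section S (row_orbit G u)"
    unfolding sign_section_def
  proof (intro conjI ballI)
    show "S \<subseteq> row_orbit G u \<union> uminus ` row_orbit G u" using sub by blast
    fix w assume w: "w \<in> row_orbit G u"
    then obtain \<gamma> where \<gamma>: "\<gamma> \<in> G" "w = u \<star> \<gamma>" by (auto simp: row_orbit_def)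
    have "f (C \<delta>) = f (C \<gamma>)" if "\<delta> \<in> G" "f (C \<delta>) = w \<or> f (C \<delta>) = - w" for \<delta>
      using f_C[OF that(1)] that(2) \<gamma> by (intro arg_cong[of _ _ f] C_eq) auto
    then have "v \<in> S \<longleftrightarrow> v = f (C \<gamma>)" if "v = w \<or> v = - w" for v
      using that \<gamma>(1) unfolding S_def by blast
    moreover have "w \<noteq> - w" using prim_nonzero(1)[OF prim_row_orbit[OF u w]] .
    ultimately show "(w \<in> S) \<noteq> (- w \<in> S)" using f_C[OF \<gamma>(1)] \<gamma>(2) by metis
  qed
  have "E_spectral G k x \<sigma> \<tau> s = infsum (eis_term k s \<tau>) S" if "Im \<tau> > 0" for k s \<tau>
  proof -
    have "E_spectral G k x \<sigma> \<tau> s = (\<Sum>\<^sub>\<infinity>D\<in>C ` G. eis_term k s \<tau> (f D))"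
      unfolding E_spectral_def cosets Let_def
    proof (rule infsum_cong)
      fix D assume "D \<in> C ` G"
      then have G: "(SOME \<gamma>. \<gamma> \<in> D) \<in> carrier SL2Z" using some_G G_SL2Z by blast
      have A: "inv\<^bsub>SL2Z\<^esub> \<sigma> \<otimes>\<^bsub>SL2Z\<^esub> (SOME \<gamma>. \<gamma> \<in> D) \<in> carrier SL2Z"
        using SL.m_closed[OF SL.inv_closed[OF \<sigma>] G] .
      have "(0, 1) \<star> (inv\<^bsub>SL2Z\<^esub> \<sigma> \<otimes>\<^bsub>SL2Z\<^esub> (SOME \<gamma>. \<gamma> \<in> D)) = f D"
        by (simp add: row_mul_mult row_mul_inv_row[OF \<sigma>] f_def u_def)
      then show "j_factor (inv\<^bsub>SL2Z\<^esub> \<sigma> \<otimes>\<^bsub>SL2Z\<^esub> (SOME \<gamma>. \<gamma> \<in> D)) \<tau> powi - int k *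
          of_real (Im (moebius (inv\<^bsub>SL2Z\<^esub> \<sigma> \<otimes>\<^bsub>SL2Z\<^esub> (SOME \<gamma>. \<gamma> \<in> D)) \<tau>)) powr s = eis_term k s \<tau> (f D)"
        using spectral_term[OF A that] by metis
    qed
    also have "\<dots> = infsum (eis_term k s \<tau>) S"
      unfolding S_def using infsum_reindex[OF inj, of "eis_term k s \<tau>"] by (simp add: o_def)
    finally show ?thesis .
  qed
  then show ?thesis using sec sub unfolding u_def by blast
qed

section \<open>Irregular cusps in terms of row orbits\<close>

text \<open>Conjugating by a scaling matrix turns \<open>u\<close> into \<open>(0, 1)\<close> and its stabilizer up to sign into a group of matrices \<open>\<plusminus>T\<^sup>t\<close>, where reversing the sign of \<open>(0, 1)\<close> means having the form \<open>-T\<^sup>t\<close>.\<close>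

lemma irregular_cusp_iff:
  assumes u: "prim u" and "- mat 1 \<notin> G"
  shows "irregular_cusp G (pole u) \<longleftrightarrow> - u \<in> row_orbit G u"
proof
  assume "irregular_cusp G (pole u)"
  then obtain \<gamma> and h :: nat where \<gamma>: "\<gamma> \<in> carrier SL2Z" "pole (inv_row \<gamma>) = pole u" and
    eq: "{inv\<^bsub>SL2Z\<^esub> \<gamma> \<otimes>\<^bsub>SL2Z\<^esub> g \<otimes>\<^bsub>SL2Z\<^esub> \<gamma> | g. g \<in> cusp_stab G (pole u)} =
           generate SL2Z {- (T_mat [^]\<^bsub>SL2Z\<^esub> h)}"
    unfolding irregular_cusp_def pole_inv_row by blast
  have "- (T_mat [^]\<^bsub>SL2Z\<^esub> h) \<in> generate SL2Z {- (T_mat [^]\<^bsub>SL2Z\<^esub> h)}" by (auto intro: generate.incl)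
  then have "- (T_mat [^]\<^bsub>SL2Z\<^esub> h) \<in>
      {inv\<^bsub>SL2Z\<^esub> \<gamma> \<otimes>\<^bsub>SL2Z\<^esub> g \<otimes>\<^bsub>SL2Z\<^esub> \<gamma> | g. g \<in> cusp_stab G (pole u)}"
    by (simp only: eq)
  then obtain g where g: "g \<in> G" and T: "trans_mat (- 1) (int h) = inv\<^bsub>SL2Z\<^esub> \<gamma> ** g ** \<gamma>"
    unfolding minus_T_power SL2Z_simps cusp_stab_pole[OF u] by blast
  have "(0, 1) \<star> trans_mat (- 1) (int h) = inv_row \<gamma> \<star> g \<star> \<gamma>"
    unfolding T by (simp only: row_mul_mult row_mul_inv_row(2)[OF \<gamma>(1)])
  then have "inv_row \<gamma> \<star> g \<star> \<gamma> = - (0, 1)" by (simp add: row_mul_def trans_mat_def)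
  then have "inv_row \<gamma> \<star> g = - (0, 1) \<star> inv\<^bsub>SL2Z\<^esub> \<gamma>"
    using row_mul_inv(2)[OF \<gamma>(1), of "inv_row \<gamma> \<star> g"] by simp
  then have "inv_row \<gamma> \<star> g = - inv_row \<gamma>" 
    by (simp only: row_mul_uminus row_mul_inv_row(2)[OF \<gamma>(1)])
  then have "- inv_row \<gamma> \<in> row_orbit G (inv_row \<gamma>)" using g unfolding row_orbit_def by (metis imageI)
  moreover have "inv_row \<gamma> = u \<or> inv_row \<gamma> = - u"
    using pole_eq_iff[OF u prim_inv_row[OF \<gamma>(1)]] \<gamma>(2) by simp
  ultimately show "- u \<in> row_orbit G u" using row_orbit_sym[of u "- u"] by auto
next
  assume "- u \<in> row_orbit G u"
  then obtain g0 where g0: "g0 \<in> G" "u \<star> g0 = - u" by (auto simp: row_orbit_def)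
  obtain \<sigma> where \<sigma>: "\<sigma> \<in> carrier SL2Z" "inv_row \<sigma> = u" using prim_imp_inv_row[OF u] by blast
  have inv_simps: "inv\<^bsub>SL2Z\<^esub> \<sigma> ** \<sigma> = mat 1" "\<sigma> ** inv\<^bsub>SL2Z\<^esub> \<sigma> = mat 1"
    using SL.l_inv[OF \<sigma>(1)] SL.r_inv[OF \<sigma>(1)] by simp_all
  define K where "K = (\<lambda>g. inv\<^bsub>SL2Z\<^esub> \<sigma> ** g ** \<sigma>) ` cusp_stab G (pole u)"
  have row: "(0, 1) \<star> (inv\<^bsub>SL2Z\<^esub> \<sigma> ** g ** \<sigma>) = u \<star> g \<star> \<sigma>" for g
    by (simp only: row_mul_mult row_mul_inv_row(2)[OF \<sigma>(1)] \<sigma>(2))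
  have row_u: "u \<star> \<sigma> = (0, 1)" using row_mul_inv_row(1)[OF \<sigma>(1)] by (simp only: \<sigma>(2))
  have form: "(0, 1) \<star> A = (0, 1) \<or> (0, 1) \<star> A = - (0, 1)" if "A \<in> K" for A
    using that unfolding K_def cusp_stab_pole[OF u] 
    by (auto simp only: row row_u row_mul_uminus image_iff mem_Collect_eq)
  have sub: "subgroup K SL2Z"
  proof (rule SL.subgroupI)
    show "K \<subseteq> carrier SL2Z"
      using SL.m_closed[OF SL.m_closed[OF SL.inv_closed[OF \<sigma>(1)]] \<sigma>(1)] G_SL2Z
      by (auto simp: K_def cusp_stab_pole[OF u])
    show "K \<noteq> {}" using G_one by (auto simp: K_def cusp_stab_pole[OF u])
  next
    fix A assume "A \<in> K"
    then obtain g where g: "g \<in> cusp_stab G (pole u)" and A: "A = inv\<^bsub>SL2Z\<^esub> \<sigma> ** g ** \<sigma>" 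
      by (auto simp: K_def)
    have gC: "g \<in> carrier SL2Z" and gG: "g \<in> G" using g G_SL2Z by (auto simp: cusp_stab_pole[OF u])
    have "inv\<^bsub>SL2Z\<^esub> g \<in> cusp_stab G (pole u)"
      using g G_inv[OF gG] row_mul_inv(2)[OF gC, of u] unfolding cusp_stab_pole[OF u]
      by (metis (mono_tags, lifting) mem_Collect_eq row_mul_uminus minus_minus)
    moreover have "inv\<^bsub>SL2Z\<^esub> A = inv\<^bsub>SL2Z\<^esub> \<sigma> ** inv\<^bsub>SL2Z\<^esub> g ** \<sigma>"
      using \<sigma>(1) gC SL.inv_mult_group[of "inv\<^bsub>SL2Z\<^esub> \<sigma> ** g" \<sigma>] SL.inv_mult_group[of "inv\<^bsub>SL2Z\<^esub> \<sigma>" g]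
        SL.m_closed[OF SL.inv_closed[OF \<sigma>(1)] gC]
      by (simp add: A matrix_mul_assoc)
    ultimately show "inv\<^bsub>SL2Z\<^esub> A \<in> K" unfolding K_def by blast
  next
    fix A B assume "A \<in> K" "B \<in> K"
    then obtain g h where g: "g \<in> cusp_stab G (pole u)" "A = inv\<^bsub>SL2Z\<^esub> \<sigma> ** g ** \<sigma>" 
      and h: "h \<in> cusp_stab G (pole u)" "B = inv\<^bsub>SL2Z\<^esub> \<sigma> ** h ** \<sigma>" 
      by (auto simp: K_def)
    have "g ** h \<in> cusp_stab G (pole u)"
      using g(1) h(1) G_mult by (auto simp: cusp_stab_pole[OF u] row_mul_mult)
    moreover have "A ** B = inv\<^bsub>SL2Z\<^esub> \<sigma> ** (g ** h) ** \<sigma>"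
    proof -
      have "A ** B = inv\<^bsub>SL2Z\<^esub> \<sigma> ** g ** (\<sigma> ** inv\<^bsub>SL2Z\<^esub> \<sigma>) ** h ** \<sigma>"
        by (simp only: g h matrix_mul_assoc)
      then show ?thesis by (simp only: inv_simps matrix_mul_rid matrix_mul_assoc)
    qed
    ultimately show "A \<otimes>\<^bsub>SL2Z\<^esub> B \<in> K" unfolding K_def by (metis SL2Z_simps(2) imageI)
  qed
  have "- mat 1 \<notin> K"
  proof
    assume "- mat 1 \<in> K"
    then obtain g where "g \<in> G" and g: "inv\<^bsub>SL2Z\<^esub> \<sigma> ** g ** \<sigma> = - mat 1" 
      by (auto simp: K_def cusp_stab_pole[OF u])
    have "g = (\<sigma> ** inv\<^bsub>SL2Z\<^esub> \<sigma>) ** g ** (\<sigma> ** inv\<^bsub>SL2Z\<^esub> \<sigma>)"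
      by (simp only: inv_simps matrix_mul_rid matrix_mul_lid)
    also have "\<dots> = \<sigma> ** (inv\<^bsub>SL2Z\<^esub> \<sigma> ** g ** \<sigma>) ** inv\<^bsub>SL2Z\<^esub> \<sigma>"
      by (simp only: matrix_mul_assoc)
    also have "\<dots> = - (\<sigma> ** inv\<^bsub>SL2Z\<^esub> \<sigma>)"
      unfolding g by (simp add: mat_eq_iff_2x2)
    finally show False using \<open>g \<in> G\<close> assms(2) inv_simps by simp
  qed
  moreover have "inv\<^bsub>SL2Z\<^esub> \<sigma> ** g0 ** \<sigma> \<in> K" using g0 by (auto simp: K_def cusp_stab_pole[OF u])
  moreover have "(0, 1) \<star> (inv\<^bsub>SL2Z\<^esub> \<sigma> ** g0 ** \<sigma>) = - (0, 1)" 
    by (simp only: row g0(2) row_mul_uminus row_u)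
  ultimately obtain h :: nat where h: "h \<ge> 1" "K = generate SL2Z {- (T_mat [^]\<^bsub>SL2Z\<^esub> h)}"
    using subgroup_without_minus_one[OF sub _ form] by metis
  have "{inv\<^bsub>SL2Z\<^esub> \<sigma> \<otimes>\<^bsub>SL2Z\<^esub> g \<otimes>\<^bsub>SL2Z\<^esub> \<sigma> | g. g \<in> cusp_stab G (pole u)} = K"
    by (auto simp: K_def)
  moreover have "moebius_rat \<sigma> Infty = pole u" by (simp only: pole_inv_row[symmetric] \<sigma>(2))
  ultimately show "irregular_cusp G (pole u)"
    unfolding irregular_cusp_def using \<sigma>(1) h by blast
qed

end

section \<open>The sum over the cusps of level \<open>N\<close> as a sum over rows\<close>

definition lex_pos :: "int \<times> int \<Rightarrow> bool" where
  "lex_pos w \<longleftrightarrow> fst w > 0 \<or> fst w = 0 \<and> snd w > 0"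

lemma lex_pos_uminus: "prim w \<Longrightarrow> lex_pos (- w) \<longleftrightarrow> \<not> lex_pos w"
  using prim_nonzero(2)[of w] by (auto simp: lex_pos_def prod_eq_iff)

text \<open>The rows over which the series of the residue class \<open>v\<close> effectively runs. For \<open>N \<le> 2\<close> the class is closed under negation and the factor \<open>1/2\<close> of \<open>eps\<close> is traded for keeping one row of each pair; then the cases \<open>N \<ge> 3\<close> and \<open>N \<le> 2\<close> can be treated alike.\<close>

definition half_class :: "nat \<Rightarrow> int \<times> int \<Rightarrow> (int \<times> int) set" where
  "half_class N v = {w. prim w \<and> red_vec N w = v \<and> (3 \<le> N \<or> lex_pos w)}"

lemma E_vec_eq_infsum:
  assumes N: "N \<ge> 1" "3 \<le> N \<or> even k" and conv: "Re (of_nat k + 2 * s) > 2" and \<tau>: "Im \<tau> > 0"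
  shows "E_vec k \<tau> v N s = infsum (eis_term k s \<tau>) (half_class N v)"
proof -
  let ?f = "eis_term k s \<tau>"
  have "{(c, d). red_vec N (c, d) = v \<and> coprime c d} = {w. prim w \<and> red_vec N w = v}"
    by (auto simp: prim_def)
  then have E: "E_vec k \<tau> v N s = eps N * infsum ?f {w. prim w \<and> red_vec N w = v}"
    by (simp add: E_vec_def eis_term_def)
  show ?thesis
  proof (cases "3 \<le> N")
    case True
    then show ?thesis by (simp add: E eps_def half_class_def)
  next
    case False
    then have "N dvd 2" using N(1) by (cases "N = 1") (auto simp: not_le less_Suc_eq numeral_3_eq_3 numeral_2_eq_2)
    then have red: "red_vec N (- w) = red_vec N w" if "prim w" for w
      using red_vec_uminus_eq_iff[OF that] by simp
    let ?P = "half_class N v"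
    have P: "?P = {w. prim w \<and> red_vec N w = v \<and> lex_pos w}" using False by (simp add: half_class_def)
    have "{w. prim w \<and> red_vec N w = v} = ?P \<union> uminus ` ?P"
    proof (intro equalityI subsetI)
      fix w assume w: "w \<in> {w. prim w \<and> red_vec N w = v}"
      show "w \<in> ?P \<union> uminus ` ?P"
      proof (cases "lex_pos w")
        case False
        then have "- w \<in> ?P" using w red[of w] lex_pos_uminus[of w] by (simp add: P)
        then show ?thesis using imageI[of "- w" ?P uminus] by simp
      qed (use w in \<open>simp add: P\<close>)
    next
      fix w assume "w \<in> ?P \<union> uminus ` ?P"
      then have "w \<in> ?P \<or> - w \<in> ?P" by (elim UnE imageE) simp_all
      then show "w \<in> {w. prim w \<and> red_vec N w = v}" using red[of w] by (auto simp: P)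
    qed
    moreover have "?P \<inter> uminus ` ?P = {}"
    proof -
      have False if "w \<in> ?P" "w \<in> uminus ` ?P" for w
      proof -
        have "- w \<in> ?P" using that(2) by (elim imageE) simp
        then show False using that(1) lex_pos_uminus[of w] by (simp add: P)
      qed
      then show ?thesis by (simp only: disjoint_iff) blast
    qed
    moreover have "?f summable_on ?P" "?f summable_on uminus ` ?P"
    proof -
      have "prim w" if "w \<in> ?P" for w using that by (simp add: P)
      then have "prim w" if "w \<in> ?P \<or> w \<in> uminus ` ?P" for w
        using that by (elim disjE imageE) (simp_all only: prim_uminus)
      then show "?f summable_on ?P" "?f summable_on uminus ` ?P"
        by (blast intro: eis_term_summable[OF \<tau> conv])+
    qed
    ultimately have "infsum ?f {w. prim w \<and> red_vec N w = v} = infsum ?f ?P + infsum ?f (uminus ` ?P)"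
      by (simp add: infsum_Un_disjoint)
    also have "infsum ?f (uminus ` ?P) = infsum (?f \<circ> uminus) ?P"
      by (rule infsum_reindex) (auto simp: inj_on_def)
    also have "?f \<circ> uminus = ?f" using N(2) False eis_term_uminus by (intro ext) (simp only: o_apply, blast)
    finally show ?thesis using False by (simp add: E eps_def)
  qed
qed

lemma pm_representatives_cases:
  assumes "N \<ge> 1" "pm_representatives N \<A>" "v \<in> Lam N"
  shows "v \<in> \<A> \<or> neg_vec N v \<in> \<A>" "v \<in> \<A> \<Longrightarrow> neg_vec N v \<in> \<A> \<Longrightarrow> neg_vec N v = v"
proof -
  have "\<exists>!w. w \<in> \<A> \<inter> {v, neg_vec N v}"
  proof -
    have "Pi_pm N v \<in> Lam_pm N" unfolding Lam_pm_def using assms(3) by (rule imageI)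
    then have "\<exists>!w. w \<in> \<A> \<inter> Pi_pm N v" using assms(2) by (simp only: pm_representatives_def)
    then show ?thesis by (simp only: Pi_pm_def)
  qed
  then show "v \<in> \<A> \<or> neg_vec N v \<in> \<A>" "v \<in> \<A> \<Longrightarrow> neg_vec N v \<in> \<A> \<Longrightarrow> neg_vec N v = v"
    by auto
qed

lemma inj_on_Pi_pm:
  assumes "N \<ge> 1" "pm_representatives N \<A>"
  shows "inj_on (Pi_pm N) \<A>" 
proof (rule inj_onI)
  fix v w assume vw: "v \<in> \<A>" "w \<in> \<A>" "Pi_pm N v = Pi_pm N w"
  have "v \<in> Lam N" "w \<in> Lam N" using assms(2) vw by (auto simp: pm_representatives_def)
  then have "v = w \<or> v = neg_vec N w" using Pi_pm_eq_iff[OF assms(1)] vw(3) by simp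
  then show "v = w" using pm_representatives_cases(2)[OF assms \<open>w \<in> Lam N\<close>] vw by auto
qed

context congruence_subgroup
begin

text \<open>By the injectivity of \<open>\<phi>\<^sub>N\<close> the sum over cusps is a sum over the representatives \<open>v \<in> \<A>\<close> that agree up to sign with a vector of the orbit; their half classes are disjoint.\<close>

lemma sum_Phi_section:
  assumes A: "pm_representatives N \<A>" and u: "prim u"
    and k: "3 \<le> N \<or> even k" and conv: "Re (of_nat k + 2 * s) > 2" and \<tau>: "Im \<tau> > 0"
  shows "(\<Sum>y\<in>or_cusps G N (pole u). Phi k N \<A> \<tau> y s) = infsum (eis_term k s \<tau>)
     (\<Union>v\<in>{v \<in> \<A>. Pi_pm N v \<in> Pi_pm N ` red_vec N ` row_orbit G u}. half_class N v)"
proof -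
  let ?Q = "Pi_pm N ` red_vec N ` row_orbit G u"
  let ?V = "{v \<in> \<A>. Pi_pm N v \<in> ?Q}"
  have inj: "inj_on (Pi_pm N) \<A>" by (rule inj_on_Pi_pm[OF level_pos A])
  have "\<A> \<subseteq> Lam N" using A by (simp add: pm_representatives_def)
  then have fin: "finite ?V" using finite_Lam[OF level_pos] by (auto intro: finite_subset)
  have Q: "?Q = Pi_pm N ` ?V"
  proof (intro equalityI subsetI)
    fix P assume P: "P \<in> ?Q"
    obtain v where v: "P = Pi_pm N v" "v \<in> red_vec N ` row_orbit G u" using P by (rule imageE)
    have L: "v \<in> Lam N" using red_row_orbit_Lam[OF u] v(2) by (rule subsetD)
    have "Pi_pm N (neg_vec N v) = P" 
      using Pi_pm_eq_iff[OF level_pos Lam_neg[OF level_pos L] L] v(1) by simp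
    with pm_representatives_cases(1)[OF level_pos A L] v(1)
    obtain a where a: "a \<in> \<A>" "P = Pi_pm N a" by metis
    then have "a \<in> ?V" using P by simp
    with a(2) show "P \<in> Pi_pm N ` ?V" by (rule image_eqI)
  next
    fix P assume "P \<in> Pi_pm N ` ?V"
    then show "P \<in> ?Q" by (elim imageE) simp
  qed
  have "(\<Sum>y\<in>or_cusps G N (pole u). Phi k N \<A> \<tau> y s) =
      (\<Sum>P\<in>phi N ` or_cusps G N (pole u). E_vec k \<tau> (inv_into \<A> (Pi_pm N) P) N s)"
    unfolding Phi_def by (subst sum.reindex[OF phi_inj[OF u]]) (simp add: o_def)
  also have "\<dots> = (\<Sum>P\<in>Pi_pm N ` ?V. E_vec k \<tau> (inv_into \<A> (Pi_pm N) P) N s)"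
    by (simp only: phi_image[OF u] Q[symmetric])
  also have "\<dots> = (\<Sum>v\<in>?V. E_vec k \<tau> v N s)"
    by (subst sum.reindex) (auto intro!: sum.cong inj_on_subset[OF inj] simp: inv_into_f_f[OF inj])
  also have "\<dots> = (\<Sum>v\<in>?V. infsum (eis_term k s \<tau>) (half_class N v))"
    by (intro sum.cong refl E_vec_eq_infsum level_pos k conv \<tau>)
  also have "\<dots> = infsum (eis_term k s \<tau>) (\<Union>v\<in>?V. half_class N v)"
    by (rule sum_infsum[OF fin]) (auto simp: half_class_def intro!: eis_term_summable[OF \<tau> conv])
  finally show ?thesis .
qed

text \<open>For \<open>N \<ge> 3\<close> a vector differs from its negative, so \<open>\<A>\<close> selects one row of each pair; for \<open>N \<le> 2\<close> it is positivity that selects it.\<close>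

lemma half_class_section:
  assumes A: "pm_representatives N \<A>" and u: "prim u"
  shows "sign_section (\<Union>v\<in>{v \<in> \<A>. Pi_pm N v \<in> Pi_pm N ` red_vec N ` row_orbit G u}. half_class N v)
    (row_orbit G u)" (is "sign_section ?S _")
proof -
  have mem: "w \<in> ?S \<longleftrightarrow> prim w \<and> red_vec N w \<in> \<A> \<and>
      Pi_pm N (red_vec N w) \<in> Pi_pm N ` red_vec N ` row_orbit G u \<and> (3 \<le> N \<or> lex_pos w)" for w
    by (auto simp: half_class_def)
  show ?thesis
    unfolding sign_section_def
  proof (intro conjI ballI subsetI)
    fix w assume "w \<in> ?S"
    then have w: "prim w" "Pi_pm N (red_vec N w) \<in> Pi_pm N ` red_vec N ` row_orbit G u"
      by (simp_all only: mem)
    obtain w0 where w0: "w0 \<in> row_orbit G u" "Pi_pm N (red_vec N w) = Pi_pm N (red_vec N w0)"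
      using w(2) by (elim imageE) metis
    have "red_vec N w \<in> Lam N" "red_vec N w0 \<in> Lam N"
      using w(1) prim_row_orbit[OF u w0(1)] by (simp_all only: red_vec_Lam[OF level_pos])
    then have "red_vec N w = red_vec N w0 \<or> red_vec N w = neg_vec N (red_vec N w0)"
      using Pi_pm_eq_iff[OF level_pos] w0(2) by simp
    moreover have "red_vec N (- w) = red_vec N w0" if "red_vec N w = neg_vec N (red_vec N w0)"
    proof -
      have "red_vec N (- w) = red_vec N (- neg_vec N (red_vec N w0))" 
        using that by (metis red_vec_uminus_red_vec)
      then show ?thesis by (simp add: neg_vec_eq)
    qed
    ultimately have "red_vec N w = red_vec N w0 \<or> red_vec N (- w) = red_vec N w0" by blast
    then have "w \<in> row_orbit G u \<or> - w \<in> row_orbit G u"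
      unfolding row_orbit_iff[OF u, of w] row_orbit_iff[OF u, of "- w"] prim_uminus
      using w(1) imageI[OF w0(1), of "red_vec N"] by metis
    then show "w \<in> row_orbit G u \<union> uminus ` row_orbit G u"
      using imageI[of "- w" "row_orbit G u" uminus] by auto
  next
    fix w assume w: "w \<in> row_orbit G u"
    have "prim w" by (rule prim_row_orbit[OF u w])
    have Q: "Pi_pm N (red_vec N w) \<in> Pi_pm N ` red_vec N ` row_orbit G u" 
      using w by (intro imageI)
    have L: "red_vec N w \<in> Lam N" using \<open>prim w\<close> by (rule red_vec_Lam[OF level_pos])
    have neg: "neg_vec N (red_vec N w) = red_vec N (- w)" by (simp add: neg_vec_eq)
    note cases = pm_representatives_cases[OF level_pos A L, unfolded neg red_vec_uminus_eq_iff[OF \<open>prim w\<close>]]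
    have dvd: "N dvd 2 \<longleftrightarrow> \<not> 3 \<le> N"
      using level_pos dvd_imp_le[of N 2] by (cases "N = 1"; cases "N = 2") auto
    have "red_vec N (- w) = red_vec N w" if "\<not> 3 \<le> N"
      using that dvd red_vec_uminus_eq_iff[OF \<open>prim w\<close>] by blast
    then show "(w \<in> ?S) \<noteq> (- w \<in> ?S)"
      unfolding mem using cases Q \<open>prim w\<close> lex_pos_uminus[OF \<open>prim w\<close>]
      by (cases "3 \<le> N") (auto simp: dvd)
  qed
qed

section \<open>The identity for a single cusp\<close>

text \<open>Both sides are sums over sign sections of the same row orbit, and the summand is even.\<close>

lemma E_spectral_eq_sum_even:
  assumes "even k" "pm_representatives N \<A>" "scaling_matrix x \<sigma>"
    "Re (of_nat k + 2 * s) > 2" "Im \<tau> > 0"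
  shows "E_spectral G k x \<sigma> \<tau> s = (\<Sum>y\<in>or_cusps G N x. Phi k N \<A> \<tau> y s)"
proof -
  define u where "u = inv_row \<sigma>"
  have u: "prim u" "x = pole u" using assms(3) prim_inv_row by (auto simp: scaling_matrix_iff u_def)
  obtain S where S: "sign_section S (row_orbit G u)"
    "E_spectral G k x \<sigma> \<tau> s = infsum (eis_term k s \<tau>) S"
    using E_spectral_section[OF assms(3)] assms(5) unfolding u_def by blast
  note S(2)
  also have "infsum (eis_term k s \<tau>) S = infsum (eis_term k s \<tau>)
      (\<Union>v\<in>{v \<in> \<A>. Pi_pm N v \<in> Pi_pm N ` red_vec N ` row_orbit G u}. half_class N v)"
    by (rule infsum_sign_section[OF S(1) half_class_section[OF assms(2) u(1)]])
       (rule eis_term_uminus[OF assms(1)])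
  also have "\<dots> = (\<Sum>y\<in>or_cusps G N x. Phi k N \<A> \<tau> y s)"
    unfolding u(2) by (rule sum_Phi_section[OF assms(2) u(1) disjI2[OF assms(1)] assms(4,5), symmetric])
  finally show ?thesis .
qed

text \<open>At a regular cusp the row orbit contains no pair of opposite rows. A section that lies inside the orbit is therefore the whole orbit, and both sides are sums over it. That the second section lies inside the orbit follows from the condition on \<open>\<A>\<close>.\<close>

lemma E_spectral_eq_sum_regular:
  assumes "3 \<le> N" "pm_representatives N \<A>" "scaling_matrix x \<sigma>"
    and reg: "- inv_row \<sigma> \<notin> row_orbit G (inv_row \<sigma>)"
    and sub: "red_vec N ` row_orbit G (inv_row \<sigma>) \<subseteq> \<A>"
    and conv: "Re (of_nat k + 2 * s) > 2" and \<tau>: "Im \<tau> > 0"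
  shows "E_spectral G k x \<sigma> \<tau> s = (\<Sum>y\<in>or_cusps G N x. Phi k N \<A> \<tau> y s)"
proof -
  define u where "u = inv_row \<sigma>"
  have u: "prim u" "x = pole u" using assms(3) prim_inv_row by (auto simp: scaling_matrix_iff u_def)
  let ?O = "row_orbit G u"
  let ?S = "\<Union>v\<in>{v \<in> \<A>. Pi_pm N v \<in> Pi_pm N ` red_vec N ` ?O}. half_class N v"
  obtain S where S: "sign_section S ?O" "S \<subseteq> ?O"
    "E_spectral G k x \<sigma> \<tau> s = infsum (eis_term k s \<tau>) S"
    using E_spectral_section[OF assms(3)] \<tau> unfolding u_def by blast
  have reg': "- w \<notin> ?O" if "w \<in> ?O" for w
    using uminus_notin_row_orbit[OF reg] that unfolding u_def by blast
  have "S = ?O" using S(1,2) reg' by (rule sign_section_eq)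
  have sec: "sign_section ?S ?O" by (rule half_class_section[OF assms(2) u(1)])
  have in_S: "w \<in> ?S" if "w \<in> ?O" for w
  proof -
    have "red_vec N w \<in> \<A>" using sub imageI[OF that, of "red_vec N"] unfolding u_def by (rule subsetD)
    moreover have "w \<in> half_class N (red_vec N w)" 
      using assms(1) prim_row_orbit[OF u(1) that] by (simp add: half_class_def)
    moreover have "Pi_pm N (red_vec N w) \<in> Pi_pm N ` red_vec N ` ?O" using that by (intro imageI)
    ultimately show ?thesis by (intro UN_I[of "red_vec N w"] CollectI conjI)
  qed
  have "?S = ?O"
  proof (rule sign_section_eq[OF sec _ reg'])
    show "?S \<subseteq> ?O"
    proof
      fix w assume w: "w \<in> ?S"
      then have "w \<in> ?O \<or> w \<in> uminus ` ?O" using subsetD[OF sign_sectionD(1)[OF sec]] by (simp only: Un_iff)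
      moreover have "w \<in> ?O" if "w \<in> uminus ` ?O"
      proof -
        have "- w \<in> ?O" using that by (elim imageE) simp
        then have "(- w \<in> ?S) \<noteq> (- (- w) \<in> ?S)" by (rule sign_sectionD(2)[OF sec])
        then show ?thesis using w in_S[OF \<open>- w \<in> ?O\<close>] by (simp only: minus_minus simp_thms)
      qed
      ultimately show "w \<in> ?O" by blast
    qed
  qed
  then have "(\<Sum>y\<in>or_cusps G N x. Phi k N \<A> \<tau> y s) = infsum (eis_term k s \<tau>) ?O"
    unfolding u(2) using sum_Phi_section[OF assms(2) u(1) disjI1[OF assms(1)] conv \<tau>] by simp
  then show ?thesis using S(3) \<open>S = ?O\<close> by simp
qed

lemma level_ge_3:
  assumes "- mat 1 \<notin> G"
  shows "3 \<le> N"
proof (rule ccontr)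
  assume "\<not> 3 \<le> N"
  then have "N = 1 \<or> N = 2" using level_pos by arith
  then have "N dvd 2" by auto
  then have "int N dvd 2 * a" for a using int_dvd_int_iff[of N 2] by (simp add: dvd_mult2)
  then have "red_vec N (v \<star> - mat 1) = red_vec N v" for v
    using dvd_minus_iff[of "int N" "2 * fst v"] dvd_minus_iff[of "int N" "2 * snd v"] 
    by (simp add: red_vec_eq_iff)
  moreover have "- mat 1 \<in> carrier SL2Z" by (simp add: SL2Z_simps(1))
  ultimately have "- mat 1 \<in> principal_congruence N" unfolding principal_congruence_iff by blast
  then show False using level assms by blast
qed

section \<open>Scaling matrices and admissible representatives\<close>

lemma cusp_class_eq_iff:
  assumes "prim u" "prim v"
  shows "pole v \<in> cusp_class G (pole u) \<longleftrightarrow> v \<in> row_orbit G u \<or> - v \<in> row_orbit G u"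
proof
  assume "pole v \<in> cusp_class G (pole u)"
  then obtain w where w: "w \<in> row_orbit G u" "pole v = pole w"
    unfolding cusp_class_pole[OF subgroup assms(1)] by (elim imageE)
  then have "w = v \<or> w = - v" using pole_eq_iff[OF assms(2) prim_row_orbit[OF assms(1) w(1)]] by simp
  then show "v \<in> row_orbit G u \<or> - v \<in> row_orbit G u" using w(1) by auto
next
  assume "v \<in> row_orbit G u \<or> - v \<in> row_orbit G u"
  then show "pole v \<in> cusp_class G (pole u)"
    unfolding cusp_class_pole[OF subgroup assms(1)] using imageI[of v _ pole] imageI[of "- v" _ pole] by auto
qed

lemma scaling_row:
  assumes "scaling_matrix x \<sigma>"
  shows "prim (inv_row \<sigma>)" "pole (inv_row \<sigma>) = x"
  using assms prim_inv_row by (auto simp: scaling_matrix_iff)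

lemma scaling_matrix_uminus: "scaling_matrix x \<sigma> \<Longrightarrow> scaling_matrix x (- \<sigma>)"
  by (simp add: scaling_matrix_iff SL2Z_simps(1))

lemma scaling_matrix_exists: "\<exists>\<sigma>. scaling_matrix x \<sigma>"
  using prim_imp_inv_row[OF prim_cusp_vec[of x]] pole_cusp_vec[of x] by (auto simp: scaling_matrix_iff)

text \<open>Passing from \<open>\<sigma>\<close> to \<open>-\<sigma>\<close> negates the row, so one of the two has its row in \<open>\<A>\<close> modulo \<open>N\<close>; admissibility extends this to the orbit, which is regular because the cusp is.\<close>

lemma scaling_from_admissible:
  assumes A: "pm_representatives N \<A>" "admissible G N \<A>" and "- mat 1 \<notin> G"
    and reg: "\<not> irregular_cusp G x"
  shows "\<exists>\<sigma>. scaling_matrix x \<sigma> \<and> red_vec N ` row_orbit G (inv_row \<sigma>) \<subseteq> \<A>"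
proof -
  obtain \<sigma> where \<sigma>: "scaling_matrix x \<sigma>" using scaling_matrix_exists by blast
  have sub: "red_vec N ` row_orbit G (inv_row \<rho>) \<subseteq> \<A>" 
    if \<rho>: "scaling_matrix x \<rho>" "red_vec N (inv_row \<rho>) \<in> \<A>" for \<rho>
  proof -
    let ?Q = "red_vec N ` row_orbit G (inv_row \<rho>)"
    note u = scaling_row[OF \<rho>(1)]
    have L: "red_vec N (inv_row \<rho>) \<in> Lam N" using u(1) by (rule red_vec_Lam[OF level_pos])
    have "?Q \<in> orbits (grp G) (Lam N) (vec_act N)"
      unfolding orbits_def orbit_vec_act[symmetric] using L by blast
    moreover have "?Q \<inter> neg_vec N ` ?Q = {}"
      using red_row_orbit_disjoint[OF u(1)] irregular_cusp_iff[OF u(1) assms(3)] reg u(2) by simp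
    moreover have "?Q \<inter> \<A> \<noteq> {}" using imageI[OF row_orbit_self, of "red_vec N"] \<rho>(2) by blast
    ultimately show ?thesis using A(2) unfolding admissible_def by blast
  qed
  note u = scaling_row[OF \<sigma>]
  have L: "red_vec N (inv_row \<sigma>) \<in> Lam N" using u(1) by (rule red_vec_Lam[OF level_pos])
  have "red_vec N (inv_row \<sigma>) \<in> \<A> \<or> red_vec N (inv_row (- \<sigma>)) \<in> \<A>"
    using pm_representatives_cases(1)[OF level_pos A(1) L] by (simp add: neg_vec_eq)
  then show ?thesis using sub \<sigma> scaling_matrix_uminus[OF \<sigma>] by blast
qed

text \<open>The orbits that belong to the scaling matrices of regular cusps must be part of \<open>\<A>\<close>; they contain no two opposite vectors, since orbits of distinct cusps are disjoint even up to sign and the cusps are regular. Every regular orbit is one of these or the negative of one, because each vector lifts to a primitive row and each row has its pole in some cusp. Hence the representatives of the other vectors can be chosen arbitrarily.\<close>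

lemma admissible_from_scaling:
  assumes R: "cusp_representatives G R" and minus: "- mat 1 \<notin> G"
    and \<sigma>: "\<And>x. x \<in> regular_cusps G R \<Longrightarrow> scaling_matrix x (\<sigma> x)"
  shows "\<exists>\<A>. pm_representatives N \<A> \<and> admissible G N \<A> \<and>
    (\<forall>x\<in>regular_cusps G R. red_vec N ` row_orbit G (inv_row (\<sigma> x)) \<subseteq> \<A>)"
proof -
  define B where "B = (\<Union>x\<in>regular_cusps G R. red_vec N ` row_orbit G (inv_row (\<sigma> x)))"
  \<comment> \<open>Away from \<open>B\<close> and its negatives, any function of the pair \<open>{v, -v}\<close> serves to select one of its members.\<close>
  define \<A> where "\<A> = B \<union> {v \<in> Lam N. v \<notin> B \<and> neg_vec N v \<notin> B \<and> v = (SOME u. u \<in> Pi_pm N v)}"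
  have BL: "B \<subseteq> Lam N"
    unfolding B_def using red_row_orbit_Lam scaling_row(1)[OF \<sigma>] by (meson UN_least)
  have B_iff: "red_vec N w \<in> B \<longleftrightarrow> (\<exists>x\<in>regular_cusps G R. w \<in> row_orbit G (inv_row (\<sigma> x)))" 
    if "prim w" for w
    unfolding B_def UN_iff using row_orbit_iff[OF scaling_row(1)[OF \<sigma>], of _ w] that
    by (intro bex_cong refl) simp
  have B_neg: "neg_vec N v \<notin> B" if v: "v \<in> B" for v
  proof
    assume neg: "neg_vec N v \<in> B"
    have "v \<in> Lam N" using BL v by (rule subsetD)
    then obtain w where w: "prim w" "v = red_vec N w" by (auto simp: Lam_eq[OF level_pos])
    then have "neg_vec N v = red_vec N (- w)" by (simp add: neg_vec_eq)
    then have "red_vec N w \<in> B" "red_vec N (- w) \<in> B" using v neg w(2) by simp_all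
    then obtain x y where x: "x \<in> regular_cusps G R" "w \<in> row_orbit G (inv_row (\<sigma> x))"
      and y: "y \<in> regular_cusps G R" "- w \<in> row_orbit G (inv_row (\<sigma> y))"
      unfolding B_iff[OF w(1)] B_iff[OF prim_uminus[THEN iffD2, OF w(1)]] by (elim bexE)
    note ux = scaling_row[OF \<sigma>[OF x(1)]] and uy = scaling_row[OF \<sigma>[OF y(1)]]
    have "x \<in> cusp_class G (pole w)" "y \<in> cusp_class G (pole w)"
      using cusp_class_eq_iff[OF w(1) ux(1)] cusp_class_eq_iff[OF w(1) uy(1)] ux(2) uy(2)
        row_orbit_sym[OF x(2)] row_orbit_sym[OF y(2)] by (auto simp: row_orbit_uminus)
    moreover have "cusp_class G (pole w) \<in> cusps G" by (auto simp: cusps_def orbits_def cusp_class_def)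
    moreover have "x \<in> R" "y \<in> R" using x(1) y(1) by (auto simp: regular_cusps_def)
    ultimately have "x = y" using R unfolding cusp_representatives_def by (metis IntI)
    have "- w \<notin> row_orbit G (inv_row (\<sigma> x))"
      using uminus_notin_row_orbit[OF _ x(2)] irregular_cusp_iff[OF ux(1) minus] ux(2) x(1) 
      by (simp add: regular_cusps_def)
    then show False using y(2) \<open>x = y\<close> by simp
  qed
  have pm: "pm_representatives N \<A>"
    unfolding pm_representatives_def
  proof (intro conjI ballI)
    show "\<A> \<subseteq> Lam N" using BL by (auto simp: \<A>_def)
    fix P assume "P \<in> Lam_pm N"
    then obtain v where v: "v \<in> Lam N" "P = {v, neg_vec N v}" by (auto simp: Lam_pm_def Pi_pm_def)
    have nn: "neg_vec N (neg_vec N v) = v" by (rule neg_vec_neg_vec[OF level_pos v(1)])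
    have Pv: "Pi_pm N v = P" "Pi_pm N (neg_vec N v) = P" using v(2) nn by (auto simp: Pi_pm_def)
    have LN: "neg_vec N v \<in> Lam N" by (rule Lam_neg[OF level_pos v(1)])
    consider "v \<in> B" | "neg_vec N v \<in> B" | "v \<notin> B" "neg_vec N v \<notin> B" by blast
    then show "\<exists>!a. a \<in> \<A> \<inter> P"
    proof cases
      case 1
      then show ?thesis using B_neg[OF 1] nn v(2) by (intro ex1I[of _ v]) (auto simp: \<A>_def)
    next
      case 2
      then show ?thesis using B_neg[OF 2] nn v(2) by (intro ex1I[of _ "neg_vec N v"]) (auto simp: \<A>_def)
    next
      case 3
      have c: "(SOME u. u \<in> P) \<in> P" using v(2) by (intro someI[of "\<lambda>u. u \<in> P" v]) simp
      have "a \<in> \<A> \<longleftrightarrow> a = (SOME u. u \<in> P)" if "a \<in> P" for a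
        using that 3 Pv v LN nn by (auto simp: \<A>_def)
      then show ?thesis using c by blast
    qed
  qed
  have adm: "admissible G N \<A>"
    unfolding admissible_def
  proof (intro ballI impI)
    fix Q assume "Q \<in> orbits (grp G) (Lam N) (vec_act N)" and disj: "Q \<inter> neg_vec N ` Q = {}"
      and meets: "Q \<inter> \<A> \<noteq> {}"
    then obtain v where v: "v \<in> Lam N" "Q = orbit (grp G) (vec_act N) v"
      unfolding orbits_def by blast
    from v(1) obtain w where w: "prim w" and "v = red_vec N w" by (auto simp: Lam_eq[OF level_pos])
    then have Q: "Q = red_vec N ` row_orbit G w" using v(2) orbit_vec_act by simp
    have "cusp_class G (pole w) \<in> cusps G" by (auto simp: cusps_def orbits_def cusp_class_def)
    then obtain x where x: "x \<in> R" "x \<in> cusp_class G (pole w)"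
      using R unfolding cusp_representatives_def by blast
    obtain \<rho> where \<rho>: "scaling_matrix x \<rho>" using scaling_matrix_exists by blast
    have orbit_eq: "row_orbit G w = row_orbit G (inv_row \<rho>) \<or> row_orbit G w = row_orbit G (- inv_row \<rho>)"
      if \<rho>: "scaling_matrix x \<rho>" for \<rho>
    proof -
      have *: "row_orbit G w = row_orbit G v" if "v \<in> row_orbit G w" for v
        using row_orbit_trans row_orbit_sym that by blast
      then show ?thesis
        using cusp_class_eq_iff[OF w scaling_row(1)[OF \<rho>]] scaling_row(2)[OF \<rho>] x(2) by blast
    qed
    \<comment> \<open>Regularity of the orbit of vectors passes to the orbit of rows, and from there to the cusp.\<close>
    have "- w \<notin> row_orbit G w"
    proof
      assume "- w \<in> row_orbit G w"
      then have "red_vec N (- w) \<in> Q" unfolding Q by (rule imageI)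
      moreover have "red_vec N (- w) \<in> neg_vec N ` Q" 
        unfolding Q using imageI[OF imageI[OF row_orbit_self[of w], of "red_vec N"], of "neg_vec N"] 
        by (simp add: neg_vec_eq)
      ultimately show False using disj by blast
    qed
    then have "- inv_row \<rho> \<notin> row_orbit G (inv_row \<rho>)"
    proof (rule contrapos_nn)
      assume neg: "- inv_row \<rho> \<in> row_orbit G (inv_row \<rho>)"
      have "inv_row \<rho> \<in> row_orbit G w \<or> - inv_row \<rho> \<in> row_orbit G w" 
        using orbit_eq[OF \<rho>] row_orbit_self by metis
      then have "inv_row \<rho> \<in> row_orbit G w \<and> - inv_row \<rho> \<in> row_orbit G w"
        using neg row_orbit_trans row_orbit_sym by blast
      then show "- w \<in> row_orbit G w"
        using uminus_notin_row_orbit[of w "inv_row \<rho>"] by blast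
    qed
    then have reg: "x \<in> regular_cusps G R"
      using irregular_cusp_iff[OF scaling_row(1)[OF \<rho>] minus] scaling_row(2)[OF \<rho>] x(1)
      by (simp add: regular_cusps_def)
    let ?O = "red_vec N ` row_orbit G (inv_row (\<sigma> x))"
    have OB: "?O \<subseteq> B" using reg by (auto simp: B_def)
    have "Q = ?O \<or> Q = neg_vec N ` ?O"
      using orbit_eq[OF \<sigma>[OF reg]] red_row_orbit_uminus[of "inv_row (\<sigma> x)"] unfolding Q by metis
    moreover have "neg_vec N ` ?O \<inter> \<A> = {}"
    proof (rule ccontr)
      assume "neg_vec N ` ?O \<inter> \<A> \<noteq> {}"
      then obtain v where "v \<in> B" "neg_vec N v \<in> \<A>" using OB by blast
      moreover have "neg_vec N (neg_vec N v) = v"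
        using neg_vec_neg_vec[OF level_pos] subsetD[OF BL] \<open>v \<in> B\<close> by blast
      ultimately show False using B_neg[of v] by (auto simp: \<A>_def)
    qed
    ultimately have "Q = ?O" using meets by blast
    then show "Q \<subseteq> \<A>" using OB by (auto simp: \<A>_def)
  qed
  have "\<forall>x\<in>regular_cusps G R. red_vec N ` row_orbit G (inv_row (\<sigma> x)) \<subseteq> \<A>"
    by (auto simp: \<A>_def B_def)
  then show ?thesis using pm adm by blast
qed

end

theorem proposition4p1:
  fixes k N :: nat and G :: "(int^2^2) set" and R :: "proj_rat set" and s :: complex
  assumes "k \<ge> 2" and "N \<ge> 1"
    and "subgroup G SL2Z" and "principal_congruence N \<subseteq> G"
    and "cusp_representatives G R"
    and "Re (of_nat k + 2 * s) > 2"
  shows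
    "(even k \<longrightarrow>
        (\<forall>\<A> \<sigma>. pm_representatives N \<A> \<longrightarrow> (\<forall>x\<in>R. scaling_matrix x (\<sigma> x)) \<longrightarrow>
           (\<forall>x\<in>R. \<forall>\<tau>. Im \<tau> > 0 \<longrightarrow>
              E_spectral G k x (\<sigma> x) \<tau> s = (\<Sum>y\<in>or_cusps G N x. Phi k N \<A> \<tau> y s)))) \<and>
     (odd k \<longrightarrow> - mat 1 \<notin> G \<longrightarrow>
        (\<forall>\<A>. pm_representatives N \<A> \<longrightarrow> admissible G N \<A> \<longrightarrow>
           (\<exists>\<sigma>. (\<forall>x\<in>regular_cusps G R. scaling_matrix x (\<sigma> x)) \<and>
              (\<forall>x\<in>regular_cusps G R. \<forall>\<tau>. Im \<tau> > 0 \<longrightarrow>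
                 E_spectral G k x (\<sigma> x) \<tau> s = (\<Sum>y\<in>or_cusps G N x. Phi k N \<A> \<tau> y s)))) \<and>
        (\<forall>\<sigma>. (\<forall>x\<in>regular_cusps G R. scaling_matrix x (\<sigma> x)) \<longrightarrow>
           (\<exists>\<A>. pm_representatives N \<A> \<and> admissible G N \<A> \<and>
              (\<forall>x\<in>regular_cusps G R. \<forall>\<tau>. Im \<tau> > 0 \<longrightarrow>
                 E_spectral G k x (\<sigma> x) \<tau> s = (\<Sum>y\<in>or_cusps G N x. Phi k N \<A> \<tau> y s)))))"
proof -
  interpret congruence_subgroup N G
    by (rule congruence_subgroup.intro[OF assms(2-4)])
  have regular: "E_spectral G k x \<sigma> \<tau> s = (\<Sum>y\<in>or_cusps G N x. Phi k N \<A> \<tau> y s)"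
    if "- mat 1 \<notin> G" "x \<in> regular_cusps G R" "scaling_matrix x \<sigma>" "pm_representatives N \<A>"
      "red_vec N ` row_orbit G (inv_row \<sigma>) \<subseteq> \<A>" "Im \<tau> > 0" for x \<sigma> \<tau> \<A>
  proof -
    have "- inv_row \<sigma> \<notin> row_orbit G (inv_row \<sigma>)"
      using irregular_cusp_iff[OF scaling_row(1)[OF that(3)] that(1)] scaling_row(2)[OF that(3)] that(2)
      by (simp add: regular_cusps_def)
    from E_spectral_eq_sum_regular[OF level_ge_3[OF that(1)] that(4,3) this that(5) assms(6) that(6)]
    show ?thesis .
  qed
  show ?thesis
  proof (intro conjI impI allI)
    fix \<A> \<sigma> assume "even k" "pm_representatives N \<A>" "\<forall>x\<in>R. scaling_matrix x (\<sigma> x)"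
    then show "\<forall>x\<in>R. \<forall>\<tau>. Im \<tau> > 0 \<longrightarrow>
        E_spectral G k x (\<sigma> x) \<tau> s = (\<Sum>y\<in>or_cusps G N x. Phi k N \<A> \<tau> y s)"
      using E_spectral_eq_sum_even assms(6) by blast
  next
    fix \<A> assume minus: "- mat 1 \<notin> G" and A: "pm_representatives N \<A>" "admissible G N \<A>"
    have "\<forall>x\<in>regular_cusps G R. \<exists>\<sigma>. scaling_matrix x \<sigma> \<and> red_vec N ` row_orbit G (inv_row \<sigma>) \<subseteq> \<A>"
      using scaling_from_admissible[OF A minus] by (simp add: regular_cusps_def)
    then obtain \<sigma> where "\<forall>x\<in>regular_cusps G R. scaling_matrix x (\<sigma> x) \<and>
        red_vec N ` row_orbit G (inv_row (\<sigma> x)) \<subseteq> \<A>"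
      by (rule bchoice[THEN exE])
    then show "\<exists>\<sigma>. (\<forall>x\<in>regular_cusps G R. scaling_matrix x (\<sigma> x)) \<and>
        (\<forall>x\<in>regular_cusps G R. \<forall>\<tau>. Im \<tau> > 0 \<longrightarrow>
          E_spectral G k x (\<sigma> x) \<tau> s = (\<Sum>y\<in>or_cusps G N x. Phi k N \<A> \<tau> y s))"
      using regular minus A(1) by (intro exI[of _ \<sigma>]) auto
  next
    fix \<sigma> assume minus: "- mat 1 \<notin> G" and \<sigma>: "\<forall>x\<in>regular_cusps G R. scaling_matrix x (\<sigma> x)"
    then obtain \<A> where "pm_representatives N \<A>" "admissible G N \<A>"
      "\<forall>x\<in>regular_cusps G R. red_vec N ` row_orbit G (inv_row (\<sigma> x)) \<subseteq> \<A>"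
      using admissible_from_scaling[OF assms(5) minus] by blast
    then show "\<exists>\<A>. pm_representatives N \<A> \<and> admissible G N \<A> \<and>
        (\<forall>x\<in>regular_cusps G R. \<forall>\<tau>. Im \<tau> > 0 \<longrightarrow>
          E_spectral G k x (\<sigma> x) \<tau> s = (\<Sum>y\<in>or_cusps G N x. Phi k N \<A> \<tau> y s))"
      using regular minus \<sigma> by (intro exI[of _ \<A>]) auto
  qed
qed

end
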